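(* Let $E_n(x)$ denote the Euler polynomials, and let $K\subset\mathbb{C}$ be the set $$K=\Big[-\tfrac{1}{\pi e},\tfrac{1}{\pi e}\Big]\ \cup\ \Big\{x\in\mathbb{C}: |x|\le \tfrac1\pi,\ \operatorname{Im}x\le 0,\ \big|\pi i x\,e^{1-\pi i x}\big|=1\Big\}\ \cup\ \Big\{x\in\mathbb{C}: |x|\le \tfrac1\pi,\ \operatorname{Im}x\ge 0,\ \big|-\pi i x\,e^{1+\pi i x}\big|=1\Big\}.$$ Then $K$ is the zero attractor of the sequence of polynomials $\{E_n(nx)\}$ (polynomials in $x$).
   Context: The Euler polynomials $E_n(x)$ are defined by the generating function $\dfrac{2e^{\xi x}}{e^{\xi}+1}=\sum_{n\ge 0}E_n(x)\dfrac{\xi^n}{n!}$. Let $\{p_n(x)\}$ be a sequence of polynomials. A set $A\subset\mathbb{C}$ is called the zero attractor of the zeros of $\{p_n(x)\}$ if the following two conditions hold: (a) for every $\varepsilon>0$, writing $A_\varepsilon:=\bigcup_{x\in A}B(x,\varepsilon)$ with $B(x,\varepsilon)$ the open disc centered at $x$ of radius $\varepsilon$, there exists an integer $n_0(\varepsilon)$ such that for all $n\ge n_0(\varepsilon)$ all zeros of $p_n(x)$ are in $A_\varepsilon$; (b) for all $x\in A$ and all $\varepsilon>0$ there exist an integer $n_1=n_1(x,\varepsilon)$ and a zero $r$ of the polynomial $p_{n_1}$ such that $r\in B(x,\varepsilon)$. *)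

theory Defs
  imports "HOL-Analysis.Analysis" "HOL-Computational_Algebra.Computational_Algebra"
begin

text \<open>
  The generating function \<open>2 e\<^sup>\<xi>\<^sup>x / (e\<^sup>\<xi> + 1)\<close> as a formal power series in \<open>\<xi>\<close> with
  coefficients in \<open>\<complex>[x]\<close>.  Power series over the ring \<open>\<complex>[x]\<close> have no library division, so
  \<open>2 / (e\<^sup>\<xi> + 1)\<close> is formed over \<open>\<complex>\<close> and its coefficients are embedded as constant polynomials.
\<close>

definition euler_gen_fun :: "complex poly fps" where
  "euler_gen_fun =
     Abs_fps (\<lambda>n. monom (1 / fact n) n) *
     Abs_fps (\<lambda>n. [:fps_nth (2 / (fps_exp 1 + 1)) n:])"

definition euler_poly :: "nat \<Rightarrow> complex poly" where
  "euler_poly n = smult (fact n) (fps_nth euler_gen_fun n)"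

lemma poly_euler_gen_fun:
  "Abs_fps (\<lambda>n. poly (euler_poly n) x / fact n) = 2 * fps_exp x / (fps_exp 1 + 1)"
proof -
  have nz: "fps_nth (fps_exp 1 + 1 :: complex fps) 0 \<noteq> 0"
    by simp
  have "2 * fps_exp x / (fps_exp 1 + 1) = fps_exp x * (2 / (fps_exp 1 + 1))"
    using nz by (simp add: fps_divide_unit mult_ac)
  moreover have "Abs_fps (\<lambda>n. poly (euler_poly n) x / fact n) = fps_exp x * (2 / (fps_exp 1 + 1))"
    by (rule fps_ext)
       (simp add: euler_poly_def euler_gen_fun_def fps_mult_nth poly_sum poly_monom mult_ac)
  ultimately show ?thesis
    by simp
qed

lemma has_fps_expansion_euler_poly:
  "(\<lambda>\<xi>. 2 * exp (x * \<xi>) / (exp \<xi> + 1)) has_fps_expansion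
     Abs_fps (\<lambda>n. poly (euler_poly n) x / fact n)"
proof -
  have "(\<lambda>\<xi>. 2 * exp (x * \<xi>) / (exp (1 * \<xi>) + 1)) has_fps_expansion
          2 * fps_exp x / (fps_exp 1 + 1)"
    by (intro has_fps_expansion_divide' has_fps_expansion_mult has_fps_expansion_add
          has_fps_expansion_exp has_fps_expansion_numeral has_fps_expansion_1) simp
  then show ?thesis
    by (simp add: poly_euler_gen_fun)
qed

definition zero_attractor :: "(nat \<Rightarrow> complex poly) \<Rightarrow> complex set \<Rightarrow> bool" where
  "zero_attractor p A \<longleftrightarrow>
     (\<forall>\<epsilon>>0. \<exists>n\<^sub>0. \<forall>n\<ge>n\<^sub>0. \<forall>z. poly (p n) z = 0 \<longrightarrow> z \<in> (\<Union>x\<in>A. ball x \<epsilon>)) \<and>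
     (\<forall>x\<in>A. \<forall>\<epsilon>>0. \<exists>n\<^sub>1 r. poly (p n\<^sub>1) r = 0 \<and> r \<in> ball x \<epsilon>)"

definition euler_attractor_set :: "complex set" where
  "euler_attractor_set =
     complex_of_real ` {- 1 / (pi * exp 1) .. 1 / (pi * exp 1)} \<union>
     {x. norm x \<le> 1 / pi \<and> Im x \<le> 0 \<and>
         norm (of_real pi * \<i> * x * exp (1 - of_real pi * \<i> * x)) = 1} \<union>
     {x. norm x \<le> 1 / pi \<and> Im x \<ge> 0 \<and>
         norm (- of_real pi * \<i> * x * exp (1 + of_real pi * \<i> * x)) = 1}"

end

theory Submission
  imports Defs "HOL-Complex_Analysis.Complex_Analysis"
begin

text \<open>
  Let \<open>q\<^sub>n(x) = E\<^sub>n(nx) / n!\<close>, the coefficient of \<open>\<xi>\<^sup>n\<close> in \<open>2 e\<^bsup>nx\<xi>\<^esup> / (e\<^sup>\<xi> + 1)\<close>.  It has a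
  contribution of size \<open>(e|x|)\<^sup>n\<close> from the saddle point \<open>\<xi> = 1/x\<close> and contributions of size
  \<open>(e\<^bsup>-s\<pi> Im x\<^esup> / \<pi>)\<^sup>n\<close> from the two nearest poles \<open>s\<pi>i\<close>, \<open>s = \<plusminus>1\<close>.  Splitting these two poles off, the
  remainder is a power series of radius \<open>3\<pi>\<close>, which can be estimated termwise, while each pole
  contributes a partial sum of the exponential series, which is Szego's classical problem.
  Away from \<open>K\<close> a single contribution dominates locally uniformly, so \<open>q\<^sub>n\<close> has no zeros there;
  compactness gives (a).  If \<open>q\<^sub>n\<close> had no zeros in a disc around a point of \<open>K\<close>, its
  \<open>n\<close>-th roots would form a normal family there; a limit has the modulus of a zero-free holomorphic
  function on an open subset of the disc, hence on all of it, although another contribution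
  dominates elsewhere in the disc.  This gives (b).

  Local uniformity at \<open>x\<^sub>0\<close> is expressed by the filter \<open>sequentially \<times>\<^sub>F nhds x\<^sub>0\<close> on pairs \<open>(n, x)\<close>.
\<close>

section \<open>Partial sums of the exponential series\<close>

text \<open>The ratio of term \<open>n - j\<close> to term \<open>n\<close> of the series of
  \<open>exp n\<close>, that is \<open>n! / ((n - j)! n^j)\<close> for \<open>j \<le> n\<close>. For
  \<open>n > 0\<close> the product vanishes once \<open>j > n\<close>, so sums over
  \<open>j \<le> n\<close> can be read as infinite series.\<close>

definition fall_ratio :: "nat \<Rightarrow> nat \<Rightarrow> real" where
  "fall_ratio n j = (\<Prod>i<j. 1 - real i / real n)"

text \<open>The counterpart beyond term \<open>n\<close>: the ratio of term \<open>n + j\<close> to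
  term \<open>n\<close> of the series of \<open>exp n\<close>.\<close>

definition rise_ratio :: "nat \<Rightarrow> nat \<Rightarrow> real" where
  "rise_ratio n j = (\<Prod>i<j. real n / real (n + Suc i))"

lemma fall_ratio_eq_0: "j > n \<Longrightarrow> n > 0 \<Longrightarrow> fall_ratio n j = 0"
  unfolding fall_ratio_def by (rule prod_zero) (auto intro!: bexI[of _ n])

lemma fall_ratio_nonneg:
  assumes "n > 0" shows "0 \<le> fall_ratio n j"
proof (cases "j \<le> n")
  case True
  then show ?thesis
    unfolding fall_ratio_def by (intro prod_nonneg) (auto simp: field_simps)
qed (use assms fall_ratio_eq_0 in force)

lemma fall_ratio_Suc: "fall_ratio n (Suc j) = fall_ratio n j * (1 - real j / real n)"
  by (simp add: fall_ratio_def)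

lemma rise_ratio_Suc: "rise_ratio n (Suc j) = rise_ratio n j * (real n / real (n + Suc j))"
  by (simp add: rise_ratio_def)

lemma fall_ratio_diff: "fall_ratio n j - fall_ratio n (Suc j) = fall_ratio n j * (j / n)"
  by (simp add: fall_ratio_Suc algebra_simps)

lemma fall_ratio_le_1:
  assumes "n > 0" shows "fall_ratio n j \<le> 1"
proof (induction j)
  case (Suc j)
  have "fall_ratio n j * (j / n) \<ge> 0"
    using fall_ratio_nonneg[OF assms] by simp
  with Suc show ?case
    using fall_ratio_diff[of n j] by linarith
qed (simp add: fall_ratio_def)

lemma rise_ratio_nonneg: "0 \<le> rise_ratio n j"
  unfolding rise_ratio_def by (intro prod_nonneg) auto

lemma rise_ratio_le_1: "rise_ratio n j \<le> 1"
  unfolding rise_ratio_def by (intro prod_le_1) (auto simp: divide_simps)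

lemma rise_ratio_diff:
  "rise_ratio n j - rise_ratio n (Suc j) = rise_ratio n j * (real (Suc j) / real (n + Suc j))"
proof -
  have "1 - real n / real (n + Suc j) = real (Suc j) / real (n + Suc j)"
    by (simp add: divide_simps)
  then show ?thesis
    unfolding rise_ratio_Suc by (metis mult.right_neutral right_diff_distrib)
qed

lemma power_over_fact_fall:
  assumes "n > 0" "j \<le> n"
  shows "real n ^ (n - j) / fact (n - j) = real n ^ n / fact n * fall_ratio n j"
  using assms(2)
proof (induction j)
  case (Suc j)
  then obtain k where k: "n = Suc (j + k)"
    by (metis less_eq_Suc_le less_imp_Suc_add)
  then have *: "n - j = Suc k" "n - Suc j = k" "real n - real j = 1 + real k" by auto
  have "real n ^ Suc k / fact (Suc k) = real n ^ n / fact n * fall_ratio n j"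
    using Suc * by simp
  then have "real n ^ n / fact n * fall_ratio n (Suc j) =
      real n ^ Suc k / fact (Suc k) * (1 - real j / real n)"
    by (simp add: fall_ratio_def)
  also have "1 - real j / real n = real (Suc k) / real n"
    using * assms by (simp add: field_simps)
  also have "real n ^ Suc k / fact (Suc k) * (real (Suc k) / real n) = real n ^ k / fact k"
    using assms by (simp add: fact_Suc del: of_nat_Suc)
  finally show ?case using * by simp
qed (simp add: fall_ratio_def)

lemma power_over_fact_rise:
  assumes "n > 0"
  shows "real n ^ (n + j) / fact (n + j) = real n ^ n / fact n * rise_ratio n j"
proof (induction j)
  case (Suc j)
  have "real n ^ (n + Suc j) / fact (n + Suc j)
      = (real n ^ (n + j) / fact (n + j)) * (real n / real (n + Suc j))"
    by (simp add: mult_ac)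
  then show ?case
    unfolding Suc.IH by (simp add: rise_ratio_def del: of_nat_add)
qed (simp add: rise_ratio_def)

text \<open>
  Summing by parts twice makes the estimates uniform on the closed unit disc away from \<open>1\<close>: the
  first differences of the coefficients are unimodal, so their total variation is at most twice
  their maximum, which is of order \<open>1 / sqrt n\<close>.
\<close>

lemma norm_abel_sum_unimodal:
  fixes b :: "nat \<Rightarrow> real" and v :: complex
  assumes nonneg: "\<And>j. 0 \<le> b j"
    and up: "\<And>j. j < m \<Longrightarrow> b j \<le> b (Suc j)"
    and down: "\<And>j. m \<le> j \<Longrightarrow> b (Suc j) \<le> b j"
    and v: "norm v \<le> 1"
  shows "norm ((1 - v) * (\<Sum>j<N. of_real (b j) * v ^ j)) \<le> 2 * b m"
proof -
  have eq: "(1 - v) * (\<Sum>j<N. of_real (b j) * v ^ j) =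
      of_real (b 0) + (\<Sum>j<N. of_real (b (Suc j) - b j) * v ^ Suc j) - of_real (b N) * v ^ N"
  proof (induction N)
    case (Suc N)
    have "(1 - v) * (\<Sum>j<Suc N. of_real (b j) * v ^ j) =
        (1 - v) * (\<Sum>j<N. of_real (b j) * v ^ j) + (1 - v) * (of_real (b N) * v ^ N)"
      by (simp add: distrib_left)
    also have "(1 - v) * (of_real (b N) * v ^ N) =
        of_real (b (Suc N) - b N) * v ^ Suc N + of_real (b N) * v ^ N - of_real (b (Suc N)) * v ^ Suc N"
      by (simp add: algebra_simps)
    finally show ?case
      unfolding Suc.IH by simp
  qed simp
  have vp: "norm v ^ k \<le> 1" for k
    using v by (simp add: power_le_one)
  have incr: "b i \<le> b j" if "i \<le> j" "j \<le> m" for i j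
    using that
  proof (induction j)
    case (Suc j)
    then show ?case using up[of j] by (cases "i = Suc j") auto
  qed simp
  \<comment> \<open>The variation telescopes separately on the rising and on the falling side of the
    peak \<open>m\<close>.\<close>
  have tv: "b 0 + (\<Sum>j<N. \<bar>b (Suc j) - b j\<bar>) = (if N \<le> m then b N else 2 * b m - b N)"
  proof (induction N)
    case (Suc N)
    show ?case
    proof (cases "N < m")
      case True
      then show ?thesis using Suc up[of N] by auto
    next
      case False
      then show ?thesis using Suc down[of N] by (cases "N = m") auto
    qed
  qed auto
  have "norm ((1 - v) * (\<Sum>j<N. of_real (b j) * v ^ j)) \<le>
      norm (of_real (b 0) + (\<Sum>j<N. of_real (b (Suc j) - b j) * v ^ Suc j)) + norm (of_real (b N) * v ^ N)"
    unfolding eq by (rule norm_triangle_ineq4)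
  also have "\<dots> \<le> norm (of_real (b 0) :: complex) + norm (\<Sum>j<N. of_real (b (Suc j) - b j) * v ^ Suc j)
      + norm (of_real (b N) * v ^ N)"
    by (intro add_right_mono norm_triangle_ineq)
  also have "norm (\<Sum>j<N. of_real (b (Suc j) - b j) * v ^ Suc j)
      \<le> (\<Sum>j<N. \<bar>b (Suc j) - b j\<bar>)"
  proof (rule sum_norm_le)
    fix j
    have "norm (of_real (b (Suc j) - b j) * v ^ Suc j) = \<bar>b (Suc j) - b j\<bar> * norm v ^ Suc j"
      by (simp only: norm_mult norm_of_real norm_power)
    also have "\<dots> \<le> \<bar>b (Suc j) - b j\<bar> * 1"
      by (intro mult_left_mono vp) auto
    finally show "norm (of_real (b (Suc j) - b j) * v ^ Suc j) \<le> \<bar>b (Suc j) - b j\<bar>" by simp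
  qed
  also have "norm (of_real (b N) * v ^ N) \<le> b N"
    using mult_left_mono[OF vp[of N] nonneg[of N]] nonneg[of N] by (simp add: norm_mult norm_power)
  also have "norm (of_real (b 0) :: complex) = b 0"
    using nonneg[of 0] by simp
  also have "b 0 + (\<Sum>j<N. \<bar>b (Suc j) - b j\<bar>) + b N \<le> 2 * b m"
    using tv incr[of N m] by (auto split: if_splits)
  finally show ?thesis by simp
qed

text \<open>The first summation by parts replaces \<open>a\<close> by its differences
  \<open>b\<close>, with \<open>a 0 = 1\<close> as leading term; the second is
  \<open>norm_abel_sum_unimodal\<close> applied to \<open>b\<close>. The remaining
  \<open>2 * a N\<close> is the boundary term.\<close>

lemma norm_abel_sum2:
  fixes a b :: "nat \<Rightarrow> real" and v :: complex
  assumes b_def: "\<And>j. a j - a (Suc j) = b j" and a: "a 0 = 1" "\<And>j. 0 \<le> a j" "\<And>j. 0 \<le> b j"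
    and up: "\<And>j. j < m \<Longrightarrow> b j \<le> b (Suc j)"
    and down: "\<And>j. m \<le> j \<Longrightarrow> b (Suc j) \<le> b j"
    and v: "norm v \<le> 1"
  shows "norm ((1 - v)\<^sup>2 * (\<Sum>j<N. of_real (a j) * v ^ j) - (1 - v)) \<le> 2 * b m + 2 * a N"
proof -
  have vp: "norm v ^ k \<le> 1" for k
    using v by (simp add: power_le_one)
  have "(1 - v) * (\<Sum>j<N. of_real (a j) * v ^ j) =
      1 - v * (\<Sum>j<N. of_real (b j) * v ^ j) - of_real (a N) * v ^ N"
  proof (induction N)
    case (Suc N)
    have "(1 - v) * (\<Sum>j<Suc N. of_real (a j) * v ^ j) =
        (1 - v) * (\<Sum>j<N. of_real (a j) * v ^ j) + (1 - v) * (of_real (a N) * v ^ N)"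
      by (simp add: distrib_left)
    also have "(1 - v) * (of_real (a N) * v ^ N) =
        of_real (a N) * v ^ N - v * (of_real (b N) * v ^ N) - of_real (a (Suc N)) * v ^ Suc N"
      unfolding b_def[symmetric] of_real_diff by (simp add: ring_distribs mult_ac)
    finally show ?case
      unfolding Suc.IH by (simp add: distrib_left)
  qed (simp add: a)
  then have eq: "(1 - v)\<^sup>2 * (\<Sum>j<N. of_real (a j) * v ^ j) - (1 - v) =
      - (v * ((1 - v) * (\<Sum>j<N. of_real (b j) * v ^ j))) - (1 - v) * (of_real (a N) * v ^ N)"
    by (simp add: power2_eq_square mult.assoc) (simp add: algebra_simps)
  have "norm (v * ((1 - v) * (\<Sum>j<N. of_real (b j) * v ^ j))) \<le> 1 * (2 * b m)"
    unfolding norm_mult[of v]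
    by (intro mult_mono v norm_abel_sum_unimodal a up down) auto
  moreover have "norm ((1 - v) * (of_real (a N) * v ^ N)) \<le> 2 * (a N * 1)"
    unfolding norm_mult norm_power
    using norm_triangle_ineq4[of 1 v] v a(2) vp by (intro mult_mono) auto
  ultimately show ?thesis
    unfolding eq by (intro order_trans[OF norm_triangle_ineq4]) simp
qed

text \<open>Twice a common bound for the largest first difference of the two ratios, whose peak
  index is about \<open>sqrt n\<close>.\<close>

definition abel_err :: "nat \<Rightarrow> real" where
  "abel_err n = 2 * ((sqrt n + 1) / n)"

lemma abel_err_tendsto: "abel_err \<longlonglongrightarrow> 0"
  unfolding abel_err_def by real_asymp

text \<open>This locates the peak of the first differences: their increment at \<open>j\<close> has
  the sign of \<open>n - f j\<close> for an increasing quadratic \<open>f\<close>, so they rise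
  exactly while \<open>f j \<le> n\<close>.\<close>

lemma ex_threshold:
  fixes f :: "nat \<Rightarrow> nat"
  assumes "mono f" "\<And>j. f j \<ge> j"
  shows "\<exists>m. \<forall>j. j < m \<longleftrightarrow> f j \<le> n"
proof (intro exI allI)
  fix j
  define m where "m = (LEAST j. n < f j)"
  have m: "n < f m"
    unfolding m_def using assms(2)[of "Suc n"] by (intro LeastI[of "\<lambda>j. n < f j" "Suc n"]) linarith
  show "j < (LEAST j. n < f j) \<longleftrightarrow> f j \<le> n"
    using m not_less_Least[of j "\<lambda>j. n < f j"] monoD[OF assms(1), of m j]
    unfolding m_def[symmetric] by linarith
qed

lemma le_sqrt_of_nat: "m * m \<le> n \<Longrightarrow> real m \<le> sqrt n"
proof -
  assume "m * m \<le> n"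
  then have "real (m * m) \<le> real n" by (simp only: of_nat_le_iff)
  then show "real m \<le> sqrt n" by (intro real_le_rsqrt) (simp add: power2_eq_square)
qed

section \<open>Comparison of the ratio sums with the geometric series\<close>

lemma norm_diff_inverse_le:
  fixes w :: complex
  assumes "w \<noteq> 0" "norm (w\<^sup>2 * S - w) \<le> e"
  shows "norm (S - 1 / w) \<le> e / (norm w)\<^sup>2"
proof -
  have "S - 1 / w = (w\<^sup>2 * S - w) / w\<^sup>2"
    using assms(1) by (simp add: diff_divide_distrib power2_eq_square)
  then show ?thesis
    using assms by (simp add: norm_divide norm_power divide_right_mono)
qed

lemma fall_ratio_sum:
  fixes v :: complex
  assumes n: "n > 0" and v: "norm v \<le> 1" "v \<noteq> 1"
  shows "norm ((\<Sum>j\<le>n. of_real (fall_ratio n j) * v ^ j) - 1 / (1 - v)) \<le> abel_err n / (norm (1 - v))\<^sup>2"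
proof -
  have "mono (\<lambda>j::nat. j * j + j)"
    by (intro monoI add_mono mult_le_mono)
  then obtain m where m: "\<And>j. j < m \<longleftrightarrow> j * j + j \<le> n"
    using ex_threshold[of "\<lambda>j. j * j + j" n] by auto
  define b where "b j = fall_ratio n j * (j / n)" for j
  note b = fall_ratio_diff[of n, folded b_def]
  \<comment> \<open>The sign of the increment is that of \<open>n - (j * j + j)\<close>, which makes
    \<open>b\<close> unimodal with peak at \<open>m\<close>.\<close>
  have b_Suc: "b (Suc j) - b j = fall_ratio n j / (real n)\<^sup>2 * (real n - real (j * j + j))" for j
    using n by (simp add: b_def fall_ratio_def field_simps power2_eq_square)
  have nn: "fall_ratio n j / (real n)\<^sup>2 \<ge> 0" for j
    using fall_ratio_nonneg[OF n] by simp
  have up: "b j \<le> b (Suc j)" if "j < m" for j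
  proof -
    have "0 \<le> b (Suc j) - b j"
      unfolding b_Suc by (rule mult_nonneg_nonneg[OF nn]) (use that m[of j] in \<open>simp only: diff_ge_0_iff_ge of_nat_le_iff\<close>)
    then show ?thesis by simp
  qed
  have down: "b (Suc j) \<le> b j" if "m \<le> j" for j
  proof -
    have "n \<le> j * j + j" using that m[of j] by linarith
    then have "real n - real (j * j + j) \<le> 0" by (simp only: diff_le_0_iff_le of_nat_le_iff)
    then have "b (Suc j) - b j \<le> 0"
      unfolding b_Suc by (rule mult_nonneg_nonpos[OF nn])
    then show ?thesis by simp
  qed
  have nonneg: "b j \<ge> 0" for j
    using fall_ratio_nonneg[OF n] by (simp add: b_def)
  have "norm ((1 - v)\<^sup>2 * (\<Sum>j<Suc n. of_real (fall_ratio n j) * v ^ j) - (1 - v))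
      \<le> 2 * b m + 2 * fall_ratio n (Suc n)"
    by (rule norm_abel_sum2[where a = "fall_ratio n" and b = b, OF b _ fall_ratio_nonneg[OF n] nonneg up down v(1)]) (simp_all add: fall_ratio_def)
  \<comment> \<open>Since the sum runs up to index \<open>n\<close>, the boundary coefficient is
    \<open>fall_ratio n (Suc n) = 0\<close>.\<close>
  also have "\<dots> = 2 * b m"
    using n by (simp add: fall_ratio_eq_0)
  also have "b m \<le> 1 * (m / n)"
    unfolding b_def by (intro mult_right_mono fall_ratio_le_1 n) auto
  also have "real m \<le> sqrt n + 1"
  proof (cases m)
    case (Suc k)
    then have "k * k \<le> n" using m[of k] by linarith
    then show ?thesis using le_sqrt_of_nat[of k n] Suc by simp
  qed auto
  finally have le: "norm ((1 - v)\<^sup>2 * (\<Sum>j\<le>n. of_real (fall_ratio n j) * v ^ j) - (1 - v)) \<le> abel_err n"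
    by (simp add: abel_err_def lessThan_Suc_atMost divide_right_mono)
  with v(2) show ?thesis
    by (intro norm_diff_inverse_le) auto
qed

text \<open>The right-hand side is the tail of the series of \<open>exp (n u)\<close> from term
  \<open>n\<close> on, divided by \<open>n^n / n!\<close>.\<close>

lemma rise_ratio_sums:
  fixes u :: complex
  assumes n: "n > 0"
  shows "(\<lambda>j. of_real (rise_ratio n j) * u ^ (n + j)) sums
     (of_real (fact n / real n ^ n) * (exp (of_nat n * u) - (\<Sum>k<n. (of_nat n * u) ^ k / fact k)))"
proof -
  have "(\<lambda>k. (of_nat n * u) ^ k /\<^sub>R fact k) sums exp (of_nat n * u)"
    by (rule exp_converges)
  then have "(\<lambda>j. (of_nat n * u) ^ (j + n) /\<^sub>R fact (j + n)) sums
      (exp (of_nat n * u) - (\<Sum>k<n. (of_nat n * u) ^ k /\<^sub>R fact k))"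
    by (rule sums_split_initial_segment)
  then have "(\<lambda>j. of_real (fact n / real n ^ n) * ((of_nat n * u) ^ (j + n) /\<^sub>R fact (j + n))) sums
      (of_real (fact n / real n ^ n) * (exp (of_nat n * u) - (\<Sum>k<n. (of_nat n * u) ^ k /\<^sub>R fact k)))"
    by (rule sums_mult)
  moreover have "of_real (fact n / real n ^ n) * ((of_nat n * u) ^ (j + n) /\<^sub>R fact (j + n)) =
     of_real (rise_ratio n j) * u ^ (n + j)" for j
  proof -
    have "rise_ratio n j = fact n / real n ^ n * (real n ^ (n + j) / fact (n + j))"
      using power_over_fact_rise[OF n, of j] n by (simp add: field_simps)
    then show ?thesis
      by (simp add: scaleR_conv_of_real power_mult_distrib divide_inverse add.commute mult_ac)
  qed
  ultimately show ?thesis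
    by (simp add: scaleR_conv_of_real field_simps)
qed

lemma rise_ratio_tendsto_0:
  assumes "n > 0" shows "rise_ratio n \<longlonglongrightarrow> 0"
proof -
  have "(\<lambda>j. complex_of_real (rise_ratio n j)) \<longlonglongrightarrow> of_real 0"
    using summable_LIMSEQ_zero[OF sums_summable[OF rise_ratio_sums[OF assms, of 1]]] by simp
  then show ?thesis
    by (simp only: tendsto_of_real_iff)
qed

text \<open>The argument is that of \<open>fall_ratio_sum\<close>, with increments of the sign of
  \<open>n - (j + 1) (j + 2)\<close>. As the series does not terminate, the bound is proved for
  partial sums and passes to the limit, where the boundary term disappears.\<close>

lemma rise_ratio_sum:
  fixes v :: complex
  assumes n: "n > 0" and v: "norm v \<le> 1" "v \<noteq> 1" and S: "(\<lambda>j. of_real (rise_ratio n j) * v ^ j) sums S"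
  shows "norm (S - 1 / (1 - v)) \<le> abel_err n / (norm (1 - v))\<^sup>2"
proof -
  have "mono (\<lambda>j. Suc j * Suc (Suc j))"
    by (intro monoI mult_le_mono) auto
  then obtain m where m: "\<And>j. j < m \<longleftrightarrow> Suc j * Suc (Suc j) \<le> n"
    using ex_threshold[of "\<lambda>j. Suc j * Suc (Suc j)" n] by auto
  define b where "b j = rise_ratio n j * (real (Suc j) / real (n + Suc j))" for j
  note b = rise_ratio_diff[of n, folded b_def]
  have b_Suc: "b (Suc j) - b j = rise_ratio n j / (real (n + Suc j) * real (n + Suc (Suc j))) *
     (real n - real (Suc j * Suc (Suc j)))" for j
  proof -
    define p q where "p = real (n + Suc j)" and "q = real (n + Suc (Suc j))"
    have pq: "p > 0" "q > 0" "q = p + 1" "real n = p - real (Suc j)" by (auto simp: p_def q_def)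
    have "rise_ratio n (Suc j) = rise_ratio n j * (real n / p)"
      by (simp add: rise_ratio_def p_def)
    then have "b (Suc j) - b j =
        rise_ratio n j * (real n / p * (real (Suc (Suc j)) / q) - real (Suc j) / p)"
      unfolding b_def p_def[symmetric] q_def[symmetric] by (simp only: right_diff_distrib mult.assoc)
    also have "real n / p * (real (Suc (Suc j)) / q) - real (Suc j) / p
        = (real n - real (Suc j * Suc (Suc j))) / (p * q)"
      using pq by (simp add: divide_simps) (simp add: algebra_simps)
    finally show ?thesis
      unfolding p_def[symmetric] q_def[symmetric] by (simp only: times_divide_eq_right times_divide_eq_left)
  qed
  have nn: "rise_ratio n j / (real (n + Suc j) * real (n + Suc (Suc j))) \<ge> 0" for j
    using rise_ratio_nonneg by simp
  have up: "b j \<le> b (Suc j)" if "j < m" for j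
  proof -
    have "0 \<le> b (Suc j) - b j"
      unfolding b_Suc by (rule mult_nonneg_nonneg[OF nn]) (use that m[of j] in \<open>simp only: diff_ge_0_iff_ge of_nat_le_iff\<close>)
    then show ?thesis by simp
  qed
  have down: "b (Suc j) \<le> b j" if "m \<le> j" for j
  proof -
    have "n \<le> Suc j * Suc (Suc j)" using that m[of j] by linarith
    then have "real n - real (Suc j * Suc (Suc j)) \<le> 0" by (simp only: diff_le_0_iff_le of_nat_le_iff)
    then have "b (Suc j) - b j \<le> 0"
      unfolding b_Suc by (rule mult_nonneg_nonpos[OF nn])
    then show ?thesis by simp
  qed
  have nonneg: "b j \<ge> 0" for j
    using rise_ratio_nonneg by (simp add: b_def)
  have *: "norm ((1 - v)\<^sup>2 * (\<Sum>j<N. of_real (rise_ratio n j) * v ^ j) - (1 - v))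
      \<le> 2 * b m + 2 * rise_ratio n N" for N
    by (rule norm_abel_sum2[where a = "rise_ratio n" and b = b, OF b _ rise_ratio_nonneg nonneg up down v(1)]) (simp_all add: rise_ratio_def)
  have "norm ((1 - v)\<^sup>2 * S - (1 - v)) \<le> 2 * b m + 2 * 0"
  proof (rule LIMSEQ_le)
    show "(\<lambda>N. norm ((1 - v)\<^sup>2 * (\<Sum>j<N. of_real (rise_ratio n j) * v ^ j) - (1 - v)))
      \<longlonglongrightarrow> norm ((1 - v)\<^sup>2 * S - (1 - v))"
      using S unfolding sums_def by (intro tendsto_intros)
    show "(\<lambda>N. 2 * b m + 2 * rise_ratio n N)
      \<longlonglongrightarrow> 2 * b m + 2 * 0"
      by (intro tendsto_intros rise_ratio_tendsto_0 n)
  qed (use * in auto)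
  also have "\<dots> = 2 * b m"
    by simp
  also have "b m \<le> 1 * (real (Suc m) / n)"
    unfolding b_def using n by (intro mult_mono rise_ratio_le_1 divide_left_mono) auto
  also have "real (Suc m) \<le> sqrt n + 1"
  proof (cases m)
    case (Suc k)
    then have "Suc k * Suc (Suc k) \<le> n" using m[of k] by simp
    then have "m * m \<le> n" using Suc by simp
    then show ?thesis using le_sqrt_of_nat[of m n] by simp
  qed (use n in auto)
  finally have le: "norm ((1 - v)\<^sup>2 * S - (1 - v)) \<le> abel_err n"
    by (simp add: abel_err_def lessThan_Suc_atMost divide_right_mono)
  with v(2) show ?thesis
    by (intro norm_diff_inverse_le) auto
qed

section \<open>Bounds of Stirling type and locally uniform geometric decay\<close>

lemma sum_power_div_fact_le_exp:
  fixes x :: real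
  assumes "finite A" "0 \<le> x"
  shows "(\<Sum>k\<in>A. x ^ k / fact k) \<le> exp x"
proof -
  have s: "(\<lambda>k. x ^ k / fact k) sums exp x"
    using exp_converges[of x] by (simp add: divide_inverse mult.commute)
  have "(\<Sum>k\<in>A. x ^ k / fact k) \<le> (\<Sum>k. x ^ k / fact k)"
    using assms by (intro sum_le_suminf sums_summable[OF s]) auto
  then show ?thesis using sums_unique[OF s] by simp
qed

lemma power_self_div_fact_le: "real n ^ n / fact n \<le> exp 1 ^ n"
  using sum_power_div_fact_le_exp[of "{n}" "real n"] exp_of_nat_mult[of n "1::real"] by simp

text \<open>A crude Stirling bound, by induction from
  \<open>(1 - 1 / (n + 1))^(n + 1) \<le> 1 / e\<close>. Together with
  \<open>power_self_div_fact_le\<close> it determines \<open>n^n / n!\<close> up to a factor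
  \<open>e n\<close>, which geometric decay absorbs and \<open>n\<close>-th roots do not
  see.\<close>

lemma fact_div_power_self_le:
  assumes "n > 0" shows "fact n / real n ^ n \<le> exp 1 * n * (1 / exp 1) ^ n"
  using assms
proof (induction n rule: nat_induct_non_zero)
  case (Suc n)
  define q where "q = real n / real (Suc n)"
  have "q \<le> exp (- 1 / real (Suc n))"
    using exp_ge_add_one_self[of "- 1 / real (Suc n)"] by (simp add: q_def field_simps)
  then have "q ^ Suc n \<le> exp (- 1 / real (Suc n)) ^ Suc n"
    by (intro power_mono) (auto simp: q_def)
  also have "\<dots> = exp (real (Suc n) * (- 1 / real (Suc n)))"
    by (rule exp_of_nat_mult[symmetric])
  also have "real (Suc n) * (- 1 / real (Suc n)) = - 1"
    by (simp add: field_simps)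
  finally have q: "q ^ Suc n \<le> 1 / exp 1"
    by (simp add: exp_minus divide_inverse)
  have "fact (Suc n) / real (Suc n) ^ Suc n = (fact n / real n ^ n) * q ^ n"
    using Suc.hyps by (simp add: q_def power_divide fact_Suc del: of_nat_Suc)
  also have "\<dots> \<le> (exp 1 * n * (1 / exp 1) ^ n) * q ^ n"
    using Suc.IH by (intro mult_right_mono) (auto simp: q_def)
  also have "\<dots> = exp 1 * real (Suc n) * (1 / exp 1) ^ n * q ^ Suc n"
    by (simp add: q_def)
  also have "\<dots> \<le> exp 1 * real (Suc n) * (1 / exp 1) ^ n * (1 / exp 1)"
    using q by (intro mult_left_mono) auto
  finally show ?case by (simp add: mult_ac)
qed auto

lemma tendsto_nat_times_power_locally:
  fixes f :: "'a \<Rightarrow> real"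
  assumes "(f \<longlongrightarrow> L) G" "L < 1" "\<forall>\<^sub>F x in G. 0 \<le> f x"
  shows "((\<lambda>p. real (fst p) * f (snd p) ^ fst p) \<longlongrightarrow> 0) (sequentially \<times>\<^sub>F G)"
proof (rule Lim_null_comparison)
  \<comment> \<open>The midpoint of \<open>L\<close> and \<open>1\<close>, replaced by
    \<open>0\<close> if it is negative, as no sign of \<open>L\<close> is assumed.\<close>
  define K where "K = max 0 ((L + 1) / 2)"
  have K: "K < 1" "0 \<le> K" "L < K" using assms(2) by (auto simp: K_def less_max_iff_disj field_simps)
  have "\<forall>\<^sub>F x in G. 0 \<le> f x \<and> f x < K"
    using order_tendstoD(2)[OF assms(1) K(3)] assms(3) by eventually_elim auto
  then have "\<forall>\<^sub>F p in sequentially \<times>\<^sub>F G. 0 \<le> f (snd p) \<and> f (snd p) < K"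
    by (rule eventually_compose_filterlim[OF _ filterlim_snd])
  then show "\<forall>\<^sub>F p in sequentially \<times>\<^sub>F G. norm (real (fst p) * f (snd p) ^ fst p) \<le> real (fst p) * K ^ fst p"
    by eventually_elim (auto simp: abs_mult intro!: mult_left_mono power_mono)
  show "((\<lambda>p. real (fst p) * K ^ fst p) \<longlongrightarrow> 0) (sequentially \<times>\<^sub>F G)"
    by (rule filterlim_compose[OF powser_times_n_limit_0 filterlim_fst]) (use K in auto)
qed

text \<open>Reversing the order of summation turns the sum into the \<open>n\<close>-th partial sum
  of the series of \<open>exp (n / v)\<close>, divided by its last term.\<close>

lemma fall_ratio_sum_eq:
  fixes v :: complex
  assumes n: "n > 0" and v: "v \<noteq> 0"
  shows "(\<Sum>j\<le>n. of_real (fall_ratio n j) * v ^ j) =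
     of_real (fact n / real n ^ n) * v ^ n * (\<Sum>k\<le>n. (of_nat n * (1 / v)) ^ k / fact k)"
proof -
  have eq: "(\<Sum>k\<le>n. (of_nat n * (1 / v)) ^ k / fact k) =
      (\<Sum>j\<le>n. (of_nat n * (1 / v)) ^ (n - j) / fact (n - j))"
    by (rule sum.reindex_bij_witness[of _ "\<lambda>i. n - i" "\<lambda>i. n - i"]) auto
  show ?thesis
    unfolding eq sum_distrib_left
  proof (rule sum.cong)
    fix j assume "j \<in> {..n}"
    then have j: "j \<le> n" by simp
    have "complex_of_real (real n ^ (n - j) / fact (n - j)) = of_real (real n ^ n / fact n * fall_ratio n j)"
      using power_over_fact_fall[OF n j] by simp
    then have *: "of_nat n ^ (n - j) / fact (n - j) = of_nat n ^ n / fact n * complex_of_real (fall_ratio n j)"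
      by simp
    have "v ^ n * (1 / v) ^ (n - j) = v ^ j"
      using v j by (simp add: power_divide power_diff)
    moreover have "of_real (fact n / real n ^ n) * v ^ n * ((of_nat n * (1 / v)) ^ (n - j) / fact (n - j)) =
        of_real (fact n / real n ^ n) * (v ^ n * (1 / v) ^ (n - j)) * (of_nat n ^ (n - j) / fact (n - j))"
      unfolding power_mult_distrib by (simp add: mult_ac)
    ultimately have "of_real (fact n / real n ^ n) * v ^ n * ((of_nat n * (1 / v)) ^ (n - j) / fact (n - j)) =
        of_real (fact n / real n ^ n) * v ^ j * (of_nat n ^ n / fact n * complex_of_real (fall_ratio n j))"
      using * by simp
    also have "\<dots> = complex_of_real (fall_ratio n j) * v ^ j"
      using n by simp
    finally show "complex_of_real (fall_ratio n j) * v ^ j =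
      of_real (fact n / real n ^ n) * v ^ n * ((of_nat n * (1 / v)) ^ (n - j) / fact (n - j))" by simp
  qed auto
qed

text \<open>With \<open>u = 1 / v\<close>, the partial sum of \<open>exp (n u)\<close> is the full
  exponential minus a tail. The tail is a rising sum at \<open>u\<close> in the closed unit disc,
  and the normalised exponential yields the first error term.\<close>

lemma fall_ratio_sum_outside:
  fixes v :: complex
  assumes n: "n > 0" and v: "norm v \<ge> 1" "v \<noteq> 1"
  shows "norm ((\<Sum>j\<le>n. of_real (fall_ratio n j) * v ^ j) - 1 / (1 - v)) \<le>
     exp 1 * n * (norm (v * exp (1 / v)) / exp 1) ^ n + abel_err n / (norm (1 - 1 / v))\<^sup>2"
proof -
  define u where "u = 1 / v"
  define T where "T = exp (of_nat n * u)"
  define c where "c = complex_of_real (fact n / real n ^ n) * v ^ n"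
  have v0: "v \<noteq> 0" using v by auto
  have u: "norm u \<le> 1" "u \<noteq> 1" "u \<noteq> 0" "u * v = 1" "v = 1 / u"
    using v v0 by (auto simp: u_def norm_divide divide_simps)
  have uv: "v ^ n * u ^ (n + j) = u ^ j" for j
    using u(4) by (simp add: power_add flip: power_mult_distrib mult.assoc) (simp add: mult.commute)
  define S where "S = c * (T - (\<Sum>k<n. (of_nat n * u) ^ k / fact k))"
  have "(\<lambda>j. v ^ n * (of_real (rise_ratio n j) * u ^ (n + j))) sums
      (v ^ n * (of_real (fact n / real n ^ n) * (exp (of_nat n * u) - (\<Sum>k<n. (of_nat n * u) ^ k / fact k))))"
    by (intro sums_mult rise_ratio_sums n)
  moreover have "v ^ n * (of_real (rise_ratio n j) * u ^ (n + j)) = of_real (rise_ratio n j) * u ^ j" for j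
    using uv[of j] by (simp add: mult.left_commute)
  ultimately have "(\<lambda>j. of_real (rise_ratio n j) * u ^ j) sums S"
    by (simp add: S_def c_def T_def mult_ac)
  then have S: "norm (S - 1 / (1 - u)) \<le> abel_err n / (norm (1 - u))\<^sup>2"
    by (rule rise_ratio_sum[OF n u(1,2)])
  have "c * ((of_nat n * u) ^ n / fact n) = (u * v) ^ n"
    using n by (simp add: c_def power_mult_distrib)
  then have 1: "c * ((of_nat n * u) ^ n / fact n) = 1"
    using u(4) by simp
  have "(\<Sum>j\<le>n. of_real (fall_ratio n j) * v ^ j) = c * (\<Sum>k\<le>n. (of_nat n * u) ^ k / fact k)"
    using fall_ratio_sum_eq[OF n v0] by (simp add: c_def u_def)
  \<comment> \<open>The tail \<open>S\<close> starts with term \<open>n\<close>, which also belongs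
    to the partial sum; after normalisation this shared term is \<open>1\<close>.\<close>
  also have "\<dots> = c * (\<Sum>k<n. (of_nat n * u) ^ k / fact k) + 1"
    unfolding lessThan_Suc_atMost[symmetric] using 1 by (simp add: distrib_left)
  also have "\<dots> = c * T - S + 1"
    by (simp add: S_def right_diff_distrib)
  finally have sum_eq: "(\<Sum>j\<le>n. of_real (fall_ratio n j) * v ^ j) = c * T - S + 1" .
  have nz: "1 - u \<noteq> 0" "1 - v \<noteq> 0" using u v by auto
  \<comment> \<open>The shared term is exactly what is needed to exchange \<open>1 / (1 - u)\<close>
    for \<open>1 / (1 - v)\<close>.\<close>
  have "1 - u = - u * (1 - v)"
    using u(4) by (simp add: right_diff_distrib)
  then have "1 / (1 - v) = - u / (1 - u)"
    using nz by (simp add: frac_eq_eq)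
  also have "\<dots> = 1 - 1 / (1 - u)"
    using nz(1) by (simp add: diff_divide_eq_iff)
  finally have eq: "(\<Sum>j\<le>n. of_real (fall_ratio n j) * v ^ j) - 1 / (1 - v) = c * T - (S - 1 / (1 - u))"
    unfolding sum_eq by simp
  have "norm (c * T) = fact n / real n ^ n * norm (v * exp u) ^ n"
    by (simp add: c_def T_def norm_mult norm_power norm_divide exp_of_nat_mult power_mult_distrib del: norm_exp_eq_Re)
  also have "\<dots> \<le> (exp 1 * n * (1 / exp 1) ^ n) * norm (v * exp u) ^ n"
    by (intro mult_right_mono fact_div_power_self_le n) auto
  also have "\<dots> = exp 1 * n * (norm (v * exp u) / exp 1) ^ n"
    by (simp add: power_divide)
  finally have "norm (c * T) \<le> exp 1 * n * (norm (v * exp u) / exp 1) ^ n" .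
  with S show ?thesis
    unfolding eq u_def
    using norm_triangle_ineq4[of "c * T" "S - 1 / (1 - 1 / v)"] by linarith
qed

lemma tendsto_abel_err_locally:
  "((\<lambda>p. abel_err (fst p)) \<longlongrightarrow> 0) (sequentially \<times>\<^sub>F G)"
  by (rule filterlim_compose[OF abel_err_tendsto filterlim_fst])

lemma eventually_fst_pos: "\<forall>\<^sub>F p in sequentially \<times>\<^sub>F G. fst p > 0"
  by (rule eventually_compose_filterlim[OF eventually_gt_at_top filterlim_fst])

text \<open>For \<open>u = 1 / v0\<close> the second alternative reads
  \<open>|u exp (1 - u)| > 1\<close>, the side of Szego's curve on which the full exponential is
  negligible against the last term of its partial sum.\<close>

lemma fall_ratio_sum_tendsto:
  fixes v0 :: complex
  assumes v0: "v0 \<noteq> 1" "norm v0 < 1 \<or> norm (v0 * exp (1 / v0)) < exp 1"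
  shows "((\<lambda>p. \<Sum>j\<le>fst p. of_real (fall_ratio (fst p) j) * snd p ^ j) \<longlongrightarrow> 1 / (1 - v0))
           (sequentially \<times>\<^sub>F nhds v0)" (is "(?Z \<longlongrightarrow> _) ?F")
proof -
  have ne: "\<forall>\<^sub>F p in ?F. snd p \<noteq> 1"
    by (rule eventually_compose_filterlim[OF _ filterlim_snd])
       (use v0(1) tendsto_imp_eventually_ne[OF filterlim_ident] in auto)
  have snd: "((\<lambda>p. snd p) \<longlongrightarrow> v0) ?F"
    by (rule filterlim_snd)
  have "((\<lambda>p. ?Z p - 1 / (1 - snd p)) \<longlongrightarrow> 0) ?F"
  proof (cases "norm v0 < 1")
    case True
    show ?thesis
    proof (rule Lim_null_comparison)
      have "\<forall>\<^sub>F p in ?F. norm (snd p) < 1"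
        by (rule order_tendstoD(2)[OF tendsto_norm[OF snd] True])
      with ne eventually_fst_pos
      show "\<forall>\<^sub>F p in ?F. norm (?Z p - 1 / (1 - snd p)) \<le> abel_err (fst p) / (norm (1 - snd p))\<^sup>2"
        by eventually_elim (intro fall_ratio_sum, auto)
      show "((\<lambda>p. abel_err (fst p) / (norm (1 - snd p))\<^sup>2) \<longlongrightarrow> 0) ?F"
      proof -
        have "((\<lambda>p. abel_err (fst p) / (norm (1 - snd p))\<^sup>2) \<longlongrightarrow> 0 / (norm (1 - v0))\<^sup>2) ?F"
          using v0 by (intro tendsto_divide tendsto_power tendsto_norm tendsto_diff tendsto_const
            tendsto_abel_err_locally snd) auto
        then show ?thesis by simp
      qed
    qed
  next
    case False
    then have v1: "norm v0 \<ge> 1" "v0 \<noteq> 0" "norm (v0 * exp (1 / v0)) / exp 1 < 1" using v0 by auto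
    \<comment> \<open>When \<open>v0\<close> is on the unit circle, points near it lie on both sides
      of the circle, so \<open>E\<close> adds the error bounds for the inside and the
      outside.\<close>
    define E where "E p = abel_err (fst p) / (norm (1 - snd p))\<^sup>2 +
      (exp 1 * (real (fst p) * (norm (snd p * exp (1 / snd p)) / exp 1) ^ fst p) +
       abel_err (fst p) / (norm (1 - 1 / snd p))\<^sup>2)" for p :: "nat \<times> complex"
    show ?thesis
    proof (rule Lim_null_comparison)
      show "\<forall>\<^sub>F p in ?F. norm (?Z p - 1 / (1 - snd p)) \<le> E p"
        using ne eventually_fst_pos
      proof eventually_elim
        case (elim p)
        have nn: "abel_err (fst p) \<ge> 0" by (simp add: abel_err_def)
        show ?case
        proof (cases "norm (snd p) \<le> 1")
          case True
          have "norm (?Z p - 1 / (1 - snd p)) \<le> abel_err (fst p) / (norm (1 - snd p))\<^sup>2"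
            using elim True by (intro fall_ratio_sum) auto
          also have "\<dots> \<le> E p"
            unfolding E_def using nn by simp
          finally show ?thesis .
        next
          case False
          have "norm (?Z p - 1 / (1 - snd p)) \<le>
              exp 1 * real (fst p) * (norm (snd p * exp (1 / snd p)) / exp 1) ^ fst p +
              abel_err (fst p) / (norm (1 - 1 / snd p))\<^sup>2"
            using elim False by (intro fall_ratio_sum_outside) auto
          also have "\<dots> \<le> E p"
            unfolding E_def using nn by (simp only: mult.assoc) simp
          finally show ?thesis .
        qed
      qed
      have "((\<lambda>v. norm (v * exp (1 / v)) / exp 1) \<longlongrightarrow> norm (v0 * exp (1 / v0)) / exp 1) (nhds v0)"
        using v1 by (intro tendsto_intros filterlim_ident) auto
      then have *: "((\<lambda>p. real (fst p) * (norm (snd p * exp (1 / snd p)) / exp 1) ^ fst p) \<longlongrightarrow> 0) ?F"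
        using v1(3) by (rule tendsto_nat_times_power_locally) simp
      have "(E \<longlongrightarrow> 0 / (norm (1 - v0))\<^sup>2 + (exp 1 * 0 + 0 / (norm (1 - 1 / v0))\<^sup>2)) ?F"
        unfolding E_def using v0 v1
        by (intro tendsto_add tendsto_mult tendsto_divide tendsto_power tendsto_norm tendsto_diff
          tendsto_const tendsto_abel_err_locally snd * ) auto
      then show "(E \<longlongrightarrow> 0) ?F" by simp
    qed
  qed
  moreover have "((\<lambda>p. 1 / (1 - snd p)) \<longlongrightarrow> 1 / (1 - v0)) ?F"
    using v0 by (intro tendsto_intros snd) auto
  ultimately have "((\<lambda>p. (?Z p - 1 / (1 - snd p)) + 1 / (1 - snd p)) \<longlongrightarrow> 0 + 1 / (1 - v0)) ?F"
    by (rule tendsto_add)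
  then show ?thesis by simp
qed

lemma fall_ratio_tendsto_1: "(\<lambda>n. fall_ratio n j) \<longlonglongrightarrow> 1"
proof (induction j)
  case (Suc j)
  have "(\<lambda>n. 1 - real j / real n) \<longlonglongrightarrow> 1"
    by real_asymp
  with Suc show ?case
    unfolding fall_ratio_Suc by (auto intro!: tendsto_eq_intros)
qed (simp add: fall_ratio_def)

section \<open>Convolution with the exponential series\<close>

text \<open>Tannery's theorem with majorant \<open>|\<beta> m| R^m\<close>: each ratio is at most
  \<open>1\<close> and tends to \<open>1\<close>, and those beyond \<open>n\<close> vanish, so the
  finite sum is an infinite series with convergent terms.\<close>

lemma fall_ratio_series_tendsto:
  fixes \<beta> :: "nat \<Rightarrow> complex"
  assumes "summable (\<lambda>m. norm (\<beta> m) * R ^ m)" "norm y0 < R"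
  shows "((\<lambda>p. \<Sum>m\<le>fst p. \<beta> m * of_real (fall_ratio (fst p) m) * snd p ^ m) \<longlongrightarrow> (\<Sum>m. \<beta> m * y0 ^ m))
           (sequentially \<times>\<^sub>F nhds y0)" (is "(_ \<longlongrightarrow> _) ?F")
proof -
  define t where "t m p = \<beta> m * of_real (fall_ratio (fst p) m) * snd p ^ m" for m and p :: "nat \<times> complex"
  have snd: "((\<lambda>p. snd p) \<longlongrightarrow> y0) ?F"
    by (rule filterlim_snd)
  have bot: "?F \<noteq> bot" by (simp add: prod_filter_eq_bot)
  have fr: "((\<lambda>p. complex_of_real (fall_ratio (fst p) m)) \<longlongrightarrow> of_real 1) ?F" for m
    by (rule tendsto_of_real, rule filterlim_compose[OF fall_ratio_tendsto_1 filterlim_fst])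
  have 1: "((\<lambda>p. t m p) \<longlongrightarrow> \<beta> m * y0 ^ m) ?F" for m
  proof -
    have "((\<lambda>p. t m p) \<longlongrightarrow> \<beta> m * of_real 1 * y0 ^ m) ?F"
      unfolding t_def by (intro tendsto_mult tendsto_const fr tendsto_power snd)
    then show ?thesis by simp
  qed
  have "\<forall>\<^sub>F p in ?F. norm (snd p) < R"
    by (rule order_tendstoD(2)[OF tendsto_norm[OF snd] assms(2)])
  then have "\<forall>\<^sub>F p in ?F. \<forall>m. norm (t m p) \<le> norm (\<beta> m) * R ^ m"
    using eventually_fst_pos
  proof eventually_elim
    case (elim p)
    show ?case
    proof
      fix m
      have "norm (t m p) = norm (\<beta> m) * fall_ratio (fst p) m * norm (snd p) ^ m"
        using fall_ratio_nonneg[OF elim(2)] by (simp add: t_def norm_mult norm_power)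
      also have "\<dots> \<le> norm (\<beta> m) * 1 * R ^ m"
        using elim by (intro mult_mono fall_ratio_le_1 power_mono fall_ratio_nonneg mult_nonneg_nonneg) auto
      finally show "norm (t m p) \<le> norm (\<beta> m) * R ^ m" by simp
    qed
  qed
  then have "\<forall>\<^sub>F q in at_top \<times>\<^sub>F ?F. norm (t (fst q) (snd q)) \<le> norm (\<beta> (fst q)) * R ^ fst q"
    by (rule eventually_mono[OF eventually_compose_filterlim[OF _ filterlim_snd]]) simp
  then have "((\<lambda>p. suminf (\<lambda>m. t m p)) \<longlongrightarrow> (\<Sum>m. \<beta> m * y0 ^ m)) ?F"
    using tannerys_theorem[OF 1 _ assms(1) bot] by (simp add: case_prod_unfold)
  moreover have "\<forall>\<^sub>F p in ?F. suminf (\<lambda>m. t m p) =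
      (\<Sum>m\<le>fst p. \<beta> m * of_real (fall_ratio (fst p) m) * snd p ^ m)"
    using eventually_fst_pos
    by eventually_elim (subst suminf_finite[of "{..fst _}"], auto simp: t_def fall_ratio_eq_0)
  ultimately show ?thesis
    by (simp add: tendsto_cong)
qed

text \<open>The coefficient of \<open>\<xi>\<^sup>n\<close> in \<open>e\<^bsup>nx\<xi>\<^esup> (\<Sum>m. \<beta>\<^sub>m \<xi>\<^sup>m)\<close>.\<close>

definition exp_conv :: "(nat \<Rightarrow> complex) \<Rightarrow> nat \<Rightarrow> complex \<Rightarrow> complex" where
  "exp_conv \<beta> n x = (\<Sum>m\<le>n. \<beta> m * ((of_nat n * x) ^ (n - m) / fact (n - m)))"

text \<open>Extracting the leading factor \<open>(n x)^n / n!\<close> leaves a perturbed power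
  series evaluated at the saddle point \<open>1 / x\<close>.\<close>

lemma exp_conv_eq_fall_ratio:
  assumes n: "n > 0" and x: "x \<noteq> 0"
  shows "exp_conv \<beta> n x = (of_nat n * x) ^ n / fact n * (\<Sum>m\<le>n. \<beta> m * of_real (fall_ratio n m) * (1 / x) ^ m)"
  unfolding exp_conv_def sum_distrib_left
proof (rule sum.cong)
  fix m assume "m \<in> {..n}"
  then have m: "m \<le> n" by simp
  have "complex_of_real (real n ^ (n - m) / fact (n - m)) = of_real (real n ^ n / fact n * fall_ratio n m)"
    using power_over_fact_fall[OF n m] by simp
  then have *: "of_nat n ^ (n - m) / fact (n - m) = of_nat n ^ n / fact n * complex_of_real (fall_ratio n m)"
    by simp
  have x': "x ^ (n - m) = x ^ n * (1 / x) ^ m"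
    using x m by (simp add: power_divide power_diff)
  have "\<beta> m * ((of_nat n * x) ^ (n - m) / fact (n - m)) = \<beta> m * (x ^ (n - m) * (of_nat n ^ (n - m) / fact (n - m)))"
    by (simp add: power_mult_distrib mult_ac)
  then show "\<beta> m * ((of_nat n * x) ^ (n - m) / fact (n - m)) =
       (of_nat n * x) ^ n / fact n * (\<beta> m * of_real (fall_ratio n m) * (1 / x) ^ m)"
    unfolding * x' by (simp add: power_mult_distrib mult_ac)
qed auto

text \<open>Cauchy's estimate on the circle of radius \<open>R\<close>, carried out on coefficients:
  every \<open>|\<beta> m|\<close> is at most a constant times \<open>R^(-m)\<close>, and what
  remains is part of the series of \<open>exp (n R |x|)\<close>.\<close>

lemma norm_exp_conv_le:
  assumes R: "R > 0" and sm: "summable (\<lambda>m. norm (\<beta> m) * R ^ m)"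
  shows "norm (exp_conv \<beta> n x) \<le> (\<Sum>m. norm (\<beta> m) * R ^ m) * (exp (R * norm x) / R) ^ n"
proof -
  define C where "C = (\<Sum>m. norm (\<beta> m) * R ^ m)"
  have C: "norm (\<beta> m) * R ^ m \<le> C" for m
    unfolding C_def using sum_le_suminf[OF sm, of "{m}"] R by auto
  have "norm (exp_conv \<beta> n x) \<le> (\<Sum>m\<le>n. C / R ^ n * ((real n * (R * norm x)) ^ (n - m) / fact (n - m)))"
    unfolding exp_conv_def
  proof (rule sum_norm_le)
    fix m assume "m \<in> {..n}"
    then have m: "m \<le> n" by simp
    have "R ^ n = R ^ m * R ^ (n - m)" using m by (simp flip: power_add)
    then have "norm (\<beta> m * ((of_nat n * x) ^ (n - m) / fact (n - m))) =
        (norm (\<beta> m) * R ^ m) / R ^ n * ((real n * (R * norm x)) ^ (n - m) / fact (n - m))"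
      using R by (simp add: norm_mult norm_divide norm_power power_mult_distrib)
    also have "\<dots> \<le> C / R ^ n * ((real n * (R * norm x)) ^ (n - m) / fact (n - m))"
      using C R by (intro mult_right_mono divide_right_mono) auto
    finally show "norm (\<beta> m * ((of_nat n * x) ^ (n - m) / fact (n - m))) \<le>
       C / R ^ n * ((real n * (R * norm x)) ^ (n - m) / fact (n - m))" .
  qed
  also have "\<dots> = C / R ^ n * (\<Sum>m\<le>n. (real n * (R * norm x)) ^ (n - m) / fact (n - m))"
    by (simp add: sum_distrib_left)
  also have "(\<Sum>m\<le>n. (real n * (R * norm x)) ^ (n - m) / fact (n - m)) = (\<Sum>k\<le>n. (real n * (R * norm x)) ^ k / fact k)"
    by (rule sum.reindex_bij_witness[of _ "\<lambda>i. n - i" "\<lambda>i. n - i"]) auto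
  also have "C / R ^ n * \<dots> \<le> C / R ^ n * exp (real n * (R * norm x))"
    using R C[of 0] order_trans[OF _ C[of 0]]
    by (intro mult_left_mono sum_power_div_fact_le_exp divide_nonneg_nonneg) auto
  also have "\<dots> = C * (exp (R * norm x) / R) ^ n"
    by (simp add: exp_of_nat_mult power_divide)
  finally show ?thesis by (simp add: C_def)
qed

text \<open>The sequence consists of the Taylor coefficients of \<open>c / (z - u)\<close> in
  \<open>u\<close>, so a simple pole at \<open>z\<close> contributes a partial sum of
  \<open>exp (n z x)\<close>.\<close>

lemma exp_conv_geometric:
  assumes "z \<noteq> 0"
  shows "exp_conv (\<lambda>m. c * (1 / z) ^ Suc m) n x =
           c * (1 / z) ^ Suc n * (\<Sum>k\<le>n. (of_nat n * (z * x)) ^ k / fact k)"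
proof -
  have eq: "(\<Sum>k\<le>n. (of_nat n * (z * x)) ^ k / fact k) =
      (\<Sum>j\<le>n. (of_nat n * (z * x)) ^ (n - j) / fact (n - j))"
    by (rule sum.reindex_bij_witness[of _ "\<lambda>i. n - i" "\<lambda>i. n - i"]) auto
  show ?thesis
    unfolding eq sum_distrib_left exp_conv_def
  proof (rule sum.cong)
    fix m assume "m \<in> {..n}"
    then have "(1 / z) ^ Suc n * z ^ (n - m) = (1 / z) ^ Suc m"
      using assms by (simp add: power_divide power_diff)
    then show "c * (1 / z) ^ Suc m * ((of_nat n * x) ^ (n - m) / fact (n - m)) =
       c * (1 / z) ^ Suc n * ((of_nat n * (z * x)) ^ (n - m) / fact (n - m))"
      by (simp add: power_mult_distrib mult_ac del: power_Suc)
  qed auto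
qed

text \<open>The tail from term \<open>n\<close> on is \<open>n^n / n!\<close> times a rising sum,
  dominated by a geometric series. Removing term \<open>n\<close> itself costs one further summand,
  whence the numerator \<open>2\<close>.\<close>

lemma norm_exp_remainder_le:
  fixes w :: complex
  assumes n: "n > 0" and w: "norm w < 1"
  shows "norm (exp (of_nat n * w) - (\<Sum>k\<le>n. (of_nat n * w) ^ k / fact k))
     \<le> (exp 1 * norm w) ^ n * (2 / (1 - norm w))"
proof -
  define r where "r = exp (of_nat n * w) - (\<Sum>k<n. (of_nat n * w) ^ k / fact k)"
  define q where "q = (of_nat n * w) ^ n / fact n"
  have q: "norm q \<le> (exp 1 * norm w) ^ n"
    using mult_right_mono[OF power_self_div_fact_le[of n], of "norm w ^ n"]
    by (simp add: q_def norm_divide norm_mult norm_power power_mult_distrib)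
  have s: "(\<lambda>j. of_real (rise_ratio n j) * w ^ (n + j)) sums (of_real (fact n / real n ^ n) * r)"
    unfolding r_def by (rule rise_ratio_sums[OF n])
  have g: "(\<lambda>j. norm w ^ n * norm w ^ j) sums (norm w ^ n * (1 / (1 - norm w)))"
    using w by (intro sums_mult geometric_sums) auto
  have "norm (\<Sum>j. of_real (rise_ratio n j) * w ^ (n + j)) \<le> (\<Sum>j. norm w ^ n * norm w ^ j)"
  proof (rule norm_suminf_le)
    fix j
    show "norm (of_real (rise_ratio n j) * w ^ (n + j)) \<le> norm w ^ n * norm w ^ j"
      using rise_ratio_nonneg[of n j] rise_ratio_le_1[of n j]
      by (simp add: norm_mult norm_power power_add mult_left_le_one_le)
  qed (use g sums_summable in blast)
  then have "norm (of_real (fact n / real n ^ n) * r) \<le> norm w ^ n * (1 / (1 - norm w))"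
    using sums_unique[OF s] sums_unique[OF g] by simp
  then have "(real n ^ n / fact n) * (fact n / real n ^ n * norm r)
      \<le> (real n ^ n / fact n) * (norm w ^ n * (1 / (1 - norm w)))"
    by (intro mult_left_mono) (auto simp: norm_mult norm_divide norm_power)
  also have "\<dots> \<le> exp 1 ^ n * (norm w ^ n * (1 / (1 - norm w)))"
    using w by (intro mult_right_mono power_self_div_fact_le) auto
  also have "\<dots> = (exp 1 * norm w) ^ n * (1 / (1 - norm w))"
    by (simp add: power_mult_distrib)
  finally have r: "norm r \<le> (exp 1 * norm w) ^ n * (1 / (1 - norm w))"
    using n by simp
  have "exp (of_nat n * w) - (\<Sum>k\<le>n. (of_nat n * w) ^ k / fact k) = r - q"
    unfolding lessThan_Suc_atMost[symmetric] by (simp add: r_def q_def)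
  then have "norm (exp (of_nat n * w) - (\<Sum>k\<le>n. (of_nat n * w) ^ k / fact k)) \<le> norm r + norm q"
    by (simp add: norm_triangle_ineq4)
  also have "\<dots> \<le> (exp 1 * norm w) ^ n * (1 / (1 - norm w)) + (exp 1 * norm w) ^ n * 1"
    using r q by simp
  also have "\<dots> = (exp 1 * norm w) ^ n * (1 / (1 - norm w) + 1)"
    by (simp only: distrib_left)
  also have "\<dots> \<le> (exp 1 * norm w) ^ n * (2 / (1 - norm w))"
  proof (intro mult_left_mono)
    have "1 \<le> 1 / (1 - norm w)" using w by simp
    then show "1 / (1 - norm w) + 1 \<le> 2 / (1 - norm w)" by simp
  qed auto
  finally show ?thesis .
qed

section \<open>Splitting off the two nearest poles\<close>

lemma holomorphic_factor_zero:
  assumes "f holomorphic_on S" "open S" "f a = 0"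
  obtains g where "g holomorphic_on S" "\<And>z. f z = (z - a) * g z" "g a = deriv f a"
proof
  show "(\<lambda>z. if z = a then deriv f a else (f z - f a) / (z - a)) holomorphic_on S"
    using assms(1,2) by (rule pole_lemma_open)
qed (use assms(3) in auto)

lemma exp_eq_minus_1_cases:
  assumes "exp z = -1" "norm z < 3 * pi"
  shows "z = \<i> * pi \<or> z = - (\<i> * pi)"
proof -
  have "exp z = exp (\<i> * pi)"
    using assms(1) by (simp add: exp_pi_i')
  then obtain n :: int where n: "z = \<i> * pi + (of_int (2 * n) * pi) * \<i>"
    unfolding exp_eq by auto
  then have z: "z = \<i> * of_real (of_int (2 * n + 1) * pi)"
    by (simp add: algebra_simps)
  then have "norm z = \<bar>of_int (2 * n + 1)\<bar> * pi"
    by (simp only: norm_mult norm_of_real abs_mult) simp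
  with assms(2) have "\<bar>real_of_int (2 * n + 1)\<bar> < 3"
    by simp
  then have "n = 0 \<or> n = -1" by linarith
  then show ?thesis using z by auto
qed

text \<open>The two simple zeros are divided out one after the other. The values of \<open>H\<close>
  at them carry the residues of \<open>2 / (exp z + 1)\<close>, through which the poles are
  cancelled below.\<close>

lemma exp_plus_1_factorization:
  obtains H where "H holomorphic_on UNIV" "\<And>z. exp z + 1 = (z - \<i> * pi) * ((z + \<i> * pi) * H z)"
    "H (\<i> * pi) = - 1 / (2 * (\<i> * pi))" "H (- (\<i> * pi)) = 1 / (2 * (\<i> * pi))"
proof -
  define p where "p = \<i> * complex_of_real pi"
  define f where "f z = exp z + 1" for z :: complex
  have p: "p \<noteq> 0" "exp p = -1" "exp (- p) = -1"
    by (simp_all add: p_def exp_pi_i' exp_minus)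
  have derf: "deriv f z = exp z" for z
    unfolding f_def by (rule DERIV_imp_deriv) (auto intro!: derivative_eq_intros)
  have "f holomorphic_on UNIV"
    unfolding f_def by (intro holomorphic_intros)
  then obtain H1 where H1: "H1 holomorphic_on UNIV" "\<And>z. f z = (z - p) * H1 z" "H1 p = deriv f p"
    using holomorphic_factor_zero[of f UNIV p] p by (auto simp: f_def)
  have "H1 (- p) = 0"
    using H1(2)[of "- p"] p by (simp add: f_def)
  with H1 obtain H where H: "H holomorphic_on UNIV" "\<And>z. H1 z = (z + p) * H z" "H (- p) = deriv H1 (- p)"
    using holomorphic_factor_zero[of H1 UNIV "- p"] by auto
  have "(H1 has_field_derivative deriv H1 (- p)) (at (- p))"
    using H1(1) by (intro holomorphic_derivI) auto
  then have "((\<lambda>z. (z - p) * H1 z) has_field_derivative (- p - p) * deriv H1 (- p)) (at (- p))"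
    using \<open>H1 (- p) = 0\<close> by (auto intro!: derivative_eq_intros)
  then have "deriv f (- p) = (- p - p) * deriv H1 (- p)"
    unfolding H1(2)[symmetric] by (rule DERIV_imp_deriv)
  then have "H (- p) = 1 / (2 * p)"
    using p H(3) derf by (simp add: field_simps)
  moreover have "2 * p * H p = - 1"
    using H(2)[of p] H1(3) derf p by simp
  then have "H p = - 1 / (2 * p)"
    using p by (simp add: field_simps)
  moreover have "exp z + 1 = (z - p) * ((z + p) * H z)" for z
    using H(2) H1(2) by (simp add: f_def)
  ultimately show ?thesis
    using that[of H] H(1) by (simp only: p_def)
qed

text \<open>Both poles have residue \<open>-2\<close>, so the two subtracted fractions are the
  principal parts. The next poles are at distance \<open>3 * pi\<close> from the origin.\<close>

lemma euler_far_holomorphic: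
  obtains A where "A holomorphic_on ball 0 (3 * pi)"
    "\<And>z. norm z < 3 * pi \<Longrightarrow> z \<noteq> \<i> * pi \<Longrightarrow> z \<noteq> - (\<i> * pi) \<Longrightarrow>
       A z = 2 / (exp z + 1) - 2 / (\<i> * pi - z) - 2 / (- (\<i> * pi) - z)"
proof -
  define p where "p = \<i> * complex_of_real pi"
  have p: "p \<noteq> 0" by (simp add: p_def)
  obtain H where H: "H holomorphic_on UNIV" "\<And>z. exp z + 1 = (z - p) * ((z + p) * H z)"
    "H p = - 1 / (2 * p)" "H (- p) = 1 / (2 * p)"
    using exp_plus_1_factorization unfolding p_def by blast
  let ?S = "ball 0 (3 * pi) :: complex set"
  have Hnz: "H z \<noteq> 0" if "z \<in> ?S" for z
  proof
    assume "H z = 0"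
    then have "exp z + 1 = 0" using H(2)[of z] by simp
    then have "exp z = -1" by (simp add: add_eq_0_iff2)
    then have "z = p \<or> z = - p"
      using that exp_eq_minus_1_cases[of z] by (simp add: p_def)
    then show False using H(3,4) \<open>H z = 0\<close> p by auto
  qed
  \<comment> \<open>The numerator of the difference over the common denominator
    \<open>(z - p) * (z + p)\<close>; the known values of \<open>H\<close> make it vanish at both
    points.\<close>
  define N where "N z = 2 / H z + 4 * z" for z
  have "N holomorphic_on ?S"
    unfolding N_def using Hnz by (intro holomorphic_intros holomorphic_on_subset[OF H(1)]) auto
  moreover have N0: "N p = 0" "N (- p) = 0"
    using p by (simp_all add: N_def H)
  ultimately obtain M where M: "M holomorphic_on ?S" "\<And>z. N z = (z - p) * M z"
    using holomorphic_factor_zero[of N ?S p] by auto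
  have "M (- p) = 0"
    using M(2)[of "- p"] N0 p by simp
  with M obtain A where A: "A holomorphic_on ?S" "\<And>z. M z = (z + p) * A z"
    using holomorphic_factor_zero[of M ?S "- p"] by (metis diff_minus_eq_add open_ball)
  show ?thesis
  proof (rule that[OF A(1)], fold p_def)
    fix z assume z: "norm z < 3 * pi" "z \<noteq> p" "z \<noteq> - p"
    then have nz: "z - p \<noteq> 0" "z + p \<noteq> 0" "H z \<noteq> 0"
      using Hnz[of z] by (auto simp: add_eq_0_iff2)
    have "A z = (2 / H z + 4 * z) / ((z - p) * (z + p))"
      using M(2)[of z] A(2)[of z] nz by (simp add: N_def)
    also have "\<dots> = 2 / (exp z + 1) + 4 * z / ((z - p) * (z + p))"
      unfolding H(2) using nz by (simp add: add_divide_distrib)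
    also have "4 * z / ((z - p) * (z + p)) = 2 / (z - p) + 2 / (z + p)"
      using nz(1,2) by (simp add: add_frac_eq)
    also have "2 / (z - p) = - (2 / (p - z))"
      by (simp only: minus_diff_eq[of z p, symmetric] divide_minus_right minus_minus)
    also have "2 / (z + p) = - (2 / (- p - z))"
    proof -
      have "- p - z = - (z + p)" by simp
      then show ?thesis by (simp only: divide_minus_right minus_minus)
    qed
    finally show "A z = 2 / (exp z + 1) - 2 / (p - z) - 2 / (- p - z)"
      by simp
  qed
qed

text \<open>In terms of the Euler polynomials this is \<open>E_m(0) / m!\<close>.\<close>

definition euler_coeff :: "nat \<Rightarrow> complex" where
  "euler_coeff m = fps_nth (2 / (fps_exp 1 + 1)) m"

definition euler_far_coeff :: "nat \<Rightarrow> complex" where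
  "euler_far_coeff m =
     euler_coeff m - 2 * (1 / (\<i> * pi)) ^ Suc m - 2 * (1 / (- (\<i> * pi))) ^ Suc m"

lemma has_fps_expansion_simple_pole:
  fixes c z :: complex
  assumes "z \<noteq> 0"
  shows "(\<lambda>u. c / (z - u)) has_fps_expansion Abs_fps (\<lambda>m. c * (1 / z) ^ Suc m)"
proof (rule has_fps_expansionI)
  have "\<forall>\<^sub>F u in nhds 0. u \<in> ball 0 (norm z)"
    using assms by (intro eventually_nhds_in_open) auto
  then show "\<forall>\<^sub>F u in nhds 0. (\<lambda>n. fps_nth (Abs_fps (\<lambda>m. c * (1 / z) ^ Suc m)) n * u ^ n) sums (c / (z - u))"
  proof eventually_elim
    case (elim u)
    then have "(\<lambda>n. c / z * (u / z) ^ n) sums (c / z * (1 / (1 - u / z)))"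
      by (intro sums_mult geometric_sums) (use assms in \<open>auto simp: norm_divide divide_simps\<close>)
    moreover have "z * (1 - u / z) = z - u"
      using assms by (simp add: right_diff_distrib)
    then have "c / z * (1 / (1 - u / z)) = c / (z - u)"
      by simp
    ultimately have "(\<lambda>n. c / z * (u / z) ^ n) sums (c / (z - u))"
      by (simp only:)
    then show ?case
      by (simp add: power_divide)
  qed
qed

text \<open>The formal expansions identify the Taylor coefficients of the holomorphic remainder at
  \<open>0\<close>; holomorphy on the disc of radius \<open>3 * pi\<close> then gives convergence
  there. The condition \<open>exp z \<noteq> -1\<close> keeps the closed form away from the removed
  poles.\<close>

lemma euler_far_sums:
  assumes "norm z < 3 * pi" "exp z \<noteq> -1"
  shows "(\<lambda>m. euler_far_coeff m * z ^ m) sums (2 / (exp z + 1) - 2 / (\<i> * pi - z) - 2 / (- (\<i> * pi) - z))"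
    and "0 \<le> R \<Longrightarrow> R < 3 * pi \<Longrightarrow> summable (\<lambda>m. norm (euler_far_coeff m) * R ^ m)"
proof -
  obtain A where A: "A holomorphic_on ball 0 (3 * pi)"
    "\<And>z. norm z < 3 * pi \<Longrightarrow> z \<noteq> \<i> * pi \<Longrightarrow> z \<noteq> - (\<i> * pi) \<Longrightarrow>
       A z = 2 / (exp z + 1) - 2 / (\<i> * pi - z) - 2 / (- (\<i> * pi) - z)"
    using euler_far_holomorphic by blast
  have "(\<lambda>z. 2 / (exp (1 * z) + 1) - 2 / (\<i> * pi - z) - 2 / (- (\<i> * pi) - z)) has_fps_expansion
     2 / (fps_exp 1 + 1) - Abs_fps (\<lambda>m. 2 * (1 / (\<i> * pi)) ^ Suc m) -
       Abs_fps (\<lambda>m. 2 * (1 / (- (\<i> * pi))) ^ Suc m)" (is "?f has_fps_expansion ?F")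
    by (intro has_fps_expansion_divide' has_fps_expansion_diff has_fps_expansion_add
          has_fps_expansion_exp has_fps_expansion_numeral has_fps_expansion_1 has_fps_expansion_simple_pole)
       auto
  moreover have "\<forall>\<^sub>F z in nhds 0. ?f z = A z"
  proof -
    have "\<forall>\<^sub>F z :: complex in nhds 0. z \<in> ball 0 pi"
      by (intro eventually_nhds_in_open) auto
    then show ?thesis
    proof eventually_elim
      case (elim z)
      have "norm z < 3 * pi"
        using elim pi_gt_zero by (simp only: mem_ball dist_0_norm)
      moreover have "z \<noteq> \<i> * pi" "z \<noteq> - (\<i> * pi)"
        using elim by (auto simp: norm_mult)
      ultimately show ?case using A(2) by simp
    qed
  qed
  moreover have "?F = Abs_fps euler_far_coeff"
    by (rule fps_ext) (simp add: euler_far_coeff_def euler_coeff_def)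
  ultimately have fps: "A has_fps_expansion Abs_fps euler_far_coeff"
    by (simp only: has_fps_expansion_cong[OF _ refl])
  have sums: "(\<lambda>m. euler_far_coeff m * z ^ m) sums A z" if "norm z < 3 * pi" for z
    using has_fps_expansion_imp_sums_complex[OF fps, of "3 * pi" z] A(1) that by simp
  have "z \<noteq> \<i> * pi" "z \<noteq> - (\<i> * pi)"
    using assms(2) by (auto simp: exp_pi_i' exp_minus)
  then show "(\<lambda>m. euler_far_coeff m * z ^ m) sums (2 / (exp z + 1) - 2 / (\<i> * pi - z) - 2 / (- (\<i> * pi) - z))"
    using sums[OF assms(1)] A(2)[OF assms(1)] by simp
  show "summable (\<lambda>m. norm (euler_far_coeff m) * R ^ m)" if R: "0 \<le> R" "R < 3 * pi"
  proof -
    \<comment> \<open>Convergence at a radius strictly between \<open>R\<close> and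
      \<open>3 * pi\<close> implies absolute convergence at \<open>R\<close>.\<close>
    define R' where "R' = (R + 3 * pi) / 2"
    have R': "R < R'" "R' < 3 * pi" "0 \<le> R'" using R by (auto simp: R'_def)
    have "summable (\<lambda>m. euler_far_coeff m * of_real R' ^ m)"
      using sums[of "of_real R'"] R' by (auto simp: sums_iff)
    then have "summable (\<lambda>m. norm (euler_far_coeff m * of_real R ^ m))"
      by (rule powser_insidea) (use R R' in auto)
    then show ?thesis
      using R by (simp add: norm_mult norm_power)
  qed
qed

text \<open>The factor \<open>fact n\<close> is nonzero, so the zeros of \<open>E_n(nx)\<close> can
  be studied through \<open>exp_conv euler_coeff n\<close>.\<close>

lemma poly_euler_poly_scaled:
  "poly (pcompose (euler_poly n) [:0, of_nat n:]) x = fact n * exp_conv euler_coeff n x"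
proof -
  have eq: "euler_gen_fun = Abs_fps (\<lambda>n. [:euler_coeff n:]) * Abs_fps (\<lambda>n. monom (1 / fact n) n)"
    unfolding euler_gen_fun_def euler_coeff_def by (rule mult.commute)
  show ?thesis
    unfolding poly_pcompose euler_poly_def eq
    by (simp add: exp_conv_def fps_mult_nth poly_sum poly_monom
        atMost_atLeast0 mult_ac)
qed

section \<open>Local asymptotics\<close>

text \<open>The region in which the saddle point dominates both poles. If
  \<open>|x| > 1 / pi\<close>, then \<open>1 / x\<close> is closer to the origin than the poles;
  otherwise \<open>e |x|\<close> must exceed the larger of the two pole rates
  \<open>exp (\<plusminus>pi Im x) / pi\<close>.\<close>

definition saddle_region :: "complex set" where
  "saddle_region = {x. norm x > 1 / pi \<or> exp (pi * \<bar>Im x\<bar>) < pi * exp 1 * norm x}"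

text \<open>For \<open>s = \<plusminus>1\<close>, the region in which the pole at \<open>s\<pi>i\<close> dominates.\<close>

definition pole_region :: "real \<Rightarrow> complex set" where
  "pole_region s = {x. norm x < 1 / pi \<and> s * Im x < 0 \<and> pi * exp 1 * norm x < exp (- s * pi * Im x)}"

lemma exp_conv_diff: "exp_conv (\<lambda>m. a m - b m) n x = exp_conv a n x - exp_conv b n x"
  unfolding exp_conv_def left_diff_distrib sum_subtractf by (rule refl)

text \<open>The sign \<open>s\<close> selects which of the two poles is listed first, so that later
  one argument treats either pole as the dominant one.\<close>

lemma exp_conv_euler_coeff:
  assumes "s = 1 \<or> s = (-1 :: real)"
  shows "exp_conv euler_coeff n x = exp_conv euler_far_coeff n x +
     2 * (1 / (\<i> * (s * pi))) ^ Suc n * (\<Sum>k\<le>n. (of_nat n * (\<i> * (s * pi) * x)) ^ k / fact k) +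
     2 * (1 / (- (\<i> * (s * pi)))) ^ Suc n * (\<Sum>k\<le>n. (of_nat n * (- (\<i> * (s * pi)) * x)) ^ k / fact k)"
proof -
  have far: "euler_far_coeff =
      (\<lambda>m. euler_coeff m - 2 * (1 / (\<i> * (s * pi))) ^ Suc m - 2 * (1 / (- (\<i> * (s * pi)))) ^ Suc m)"
    using assms by (intro ext, elim disjE) (simp_all add: euler_far_coeff_def)
  have nz: "\<i> * (s * pi) \<noteq> 0" "- (\<i> * (s * pi)) \<noteq> 0"
    using assms by auto
  have *: "E = F + a + b" if "F = E - a - b" for E F a b :: complex
    using that by simp
  show ?thesis
    unfolding far exp_conv_diff exp_conv_geometric[OF nz(1)] exp_conv_geometric[OF nz(2)]
    by (rule *) (rule refl)
qed

lemma pole_sum_tendsto: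
  fixes y0 z :: complex
  assumes "z \<noteq> 0" "y0 \<noteq> z" "norm (y0 / z) < 1 \<or> norm (y0 / z * exp (1 / (y0 / z))) < exp 1"
  shows "((\<lambda>p. \<Sum>m\<le>fst p. 2 * (1 / z) ^ Suc m * of_real (fall_ratio (fst p) m) * snd p ^ m)
     \<longlongrightarrow> 2 / (z - y0)) (sequentially \<times>\<^sub>F nhds y0)"
proof -
  have lim: "filterlim (\<lambda>p. (fst p, snd p / z)) (sequentially \<times>\<^sub>F nhds (y0 / z)) (sequentially \<times>\<^sub>F nhds y0)"
    by (intro filterlim_Pair filterlim_fst tendsto_divide tendsto_const filterlim_snd assms(1))
  have "((\<lambda>p. 2 / z * (\<Sum>j\<le>fst p. of_real (fall_ratio (fst p) j) * (snd p / z) ^ j))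
      \<longlongrightarrow> 2 / z * (1 / (1 - y0 / z))) (sequentially \<times>\<^sub>F nhds y0)"
    using filterlim_compose[OF fall_ratio_sum_tendsto lim] assms
    by (intro tendsto_mult tendsto_const) simp
  moreover have "2 / z * (\<Sum>j\<le>n. of_real (fall_ratio n j) * (y / z) ^ j) =
      (\<Sum>m\<le>n. 2 * (1 / z) ^ Suc m * of_real (fall_ratio n m) * y ^ m)" for n y
    by (simp add: sum_distrib_left power_divide mult_ac)
  moreover have "z * (1 - y0 / z) = z - y0"
    using assms by (simp add: right_diff_distrib)
  then have "2 / z * (1 / (1 - y0 / z)) = 2 / (z - y0)"
    by simp
  ultimately show ?thesis by (simp only:)
qed

text \<open>The power series of \<open>2 / (exp y + 1)\<close> has radius only \<open>pi\<close>.
  Beyond it the limit still holds: the far part converges up to \<open>3 * pi\<close>, and Szego's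
  condition controls the truncated sum of each pole.\<close>

lemma saddle_sum_tendsto:
  assumes y0: "norm y0 < 3 * pi" "exp y0 \<noteq> -1"
    and s: "\<And>s. s = 1 \<or> s = (-1 :: real) \<Longrightarrow>
      norm (y0 / (\<i> * (s * pi))) < 1 \<or> norm (y0 / (\<i> * (s * pi)) * exp (1 / (y0 / (\<i> * (s * pi))))) < exp 1"
  shows "((\<lambda>p. \<Sum>m\<le>fst p. euler_coeff m * of_real (fall_ratio (fst p) m) * snd p ^ m)
     \<longlongrightarrow> 2 / (exp y0 + 1)) (sequentially \<times>\<^sub>F nhds y0)"
proof -
  define R where "R = (norm y0 + 3 * pi) / 2"
  have R: "norm y0 < R" "R < 3 * pi" using y0(1) by (simp_all add: R_def)
  then have "0 \<le> R" using norm_ge_zero[of y0] by linarith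
  note R = R this
  have ne: "y0 \<noteq> \<i> * pi" "y0 \<noteq> - (\<i> * pi)"
    using y0(2) by (auto simp: exp_pi_i' exp_minus)
  have "((\<lambda>p. (\<Sum>m\<le>fst p. euler_far_coeff m * of_real (fall_ratio (fst p) m) * snd p ^ m) +
         (\<Sum>m\<le>fst p. 2 * (1 / (\<i> * pi)) ^ Suc m * of_real (fall_ratio (fst p) m) * snd p ^ m) +
         (\<Sum>m\<le>fst p. 2 * (1 / (- (\<i> * pi))) ^ Suc m * of_real (fall_ratio (fst p) m) * snd p ^ m))
     \<longlongrightarrow> (\<Sum>m. euler_far_coeff m * y0 ^ m) + 2 / (\<i> * pi - y0) + 2 / (- (\<i> * pi) - y0))
     (sequentially \<times>\<^sub>F nhds y0)"
    using s[of 1] s[of "-1"] ne R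
    by (intro tendsto_add fall_ratio_series_tendsto[where R = R] pole_sum_tendsto euler_far_sums(2)[OF y0])
       auto
  moreover have "(\<Sum>m. euler_far_coeff m * y0 ^ m) + 2 / (\<i> * pi - y0) + 2 / (- (\<i> * pi) - y0) = 2 / (exp y0 + 1)"
    unfolding sums_unique[OF euler_far_sums(1)[OF y0], symmetric] by simp
  moreover have "(\<Sum>m\<le>n. euler_far_coeff m * of_real (fall_ratio n m) * y ^ m) +
         (\<Sum>m\<le>n. 2 * (1 / (\<i> * pi)) ^ Suc m * of_real (fall_ratio n m) * y ^ m) +
         (\<Sum>m\<le>n. 2 * (1 / (- (\<i> * pi))) ^ Suc m * of_real (fall_ratio n m) * y ^ m) =
       (\<Sum>m\<le>n. euler_coeff m * of_real (fall_ratio n m) * y ^ m)" for n y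
    unfolding sum.distrib[symmetric] distrib_right[symmetric]
    by (simp add: euler_far_coeff_def)
  ultimately show ?thesis by (simp only:)
qed

lemma saddle_region_tendsto:
  assumes x0: "x0 \<in> saddle_region"
  shows "((\<lambda>p. \<Sum>m\<le>fst p. euler_coeff m * of_real (fall_ratio (fst p) m) * (1 / snd p) ^ m)
     \<longlongrightarrow> 2 / (exp (1 / x0) + 1)) (sequentially \<times>\<^sub>F nhds x0)"
    and "x0 \<noteq> 0" and "exp (1 / x0) \<noteq> -1"
proof -
  have e3: "exp 1 < (3 :: real)" using e_less_272 by simp
  have pi0: "pi > 0" by simp
  \<comment> \<open>As \<open>e < 3\<close>, this bound puts \<open>1 / x0\<close> inside the disc
    of radius \<open>3 * pi\<close>.\<close>
  have nx: "norm x0 > 1 / (pi * exp 1)"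
  proof (cases "norm x0 > 1 / pi")
    case True
    have "1 / (pi * exp 1) \<le> 1 / pi"
      by (intro divide_left_mono) auto
    with True show ?thesis by linarith
  next
    case False
    then have "exp (pi * \<bar>Im x0\<bar>) < pi * exp 1 * norm x0"
      using x0 by (simp add: saddle_region_def)
    moreover have "1 \<le> exp (pi * \<bar>Im x0\<bar>)" by simp
    ultimately have "1 < pi * exp 1 * norm x0" by linarith
    then show ?thesis by (simp add: divide_less_eq mult.commute)
  qed
  moreover have "1 / (pi * exp 1) > 0" by simp
  ultimately have n0: "norm x0 > 0" by linarith
  then show xnz: "x0 \<noteq> 0" by auto
  have "1 / norm x0 < pi * exp 1"
    using nx n0 by (simp add: divide_less_eq mult.commute)
  also have "\<dots> < pi * 3" using e3 by simp
  finally have y1: "norm (1 / x0) < 3 * pi" by (simp add: norm_divide)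
  \<comment> \<open>At the two candidates \<open>|x0| = |Im x0| = 1 / pi\<close>, where both sides
    of the inequality defining the region equal \<open>e\<close>.\<close>
  have y2: "exp (1 / x0) \<noteq> -1"
  proof
    assume "exp (1 / x0) = -1"
    then have "1 / x0 = \<i> * pi \<or> 1 / x0 = - (\<i> * pi)"
      using exp_eq_minus_1_cases y1 by blast
    then have "x0 = 1 / (\<i> * pi) \<or> x0 = 1 / (- (\<i> * pi))"
      by (metis div_by_1 divide_divide_eq_right mult_1)
    moreover have "1 / (\<i> * pi) = of_real (- 1 / pi) * \<i>"
      by (subst divide_eq_eq) simp
    then have "1 / (- (\<i> * pi)) = of_real (1 / pi) * \<i>"
      by (simp add: divide_minus_right)
    ultimately have "x0 = of_real (- 1 / pi) * \<i> \<or> x0 = of_real (1 / pi) * \<i>"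
      using \<open>1 / (\<i> * pi) = of_real (- 1 / pi) * \<i>\<close> by (simp only:)
    then have "norm x0 = 1 / pi" "\<bar>Im x0\<bar> = 1 / pi"
      by (auto simp: norm_mult norm_divide)
    then show False using x0 by (simp add: saddle_region_def)
  qed
  then show "exp (1 / x0) \<noteq> -1" .
  \<comment> \<open>For \<open>v = 1 / (x0 s pi \<i>)\<close> one has
    \<open>|v exp (1 / v)| = exp (- s pi Im x0) / (pi |x0|)\<close>, so the region's inequality
    gives Szego's condition at both poles.\<close>
  have s: "norm (1 / x0 / (\<i> * (s * pi))) < 1 \<or>
     norm (1 / x0 / (\<i> * (s * pi)) * exp (1 / (1 / x0 / (\<i> * (s * pi))))) < exp 1"
    if "s = 1 \<or> s = (-1 :: real)" for s
  proof (cases "norm x0 > 1 / pi")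
    case True
    have "norm (1 / x0 / (\<i> * (s * pi))) = 1 / (norm x0 * pi)"
      using that by (auto simp: norm_divide norm_mult)
    also have "\<dots> < 1" using True n0 by (simp add: divide_less_eq)
    finally show ?thesis ..
  next
    case False
    then have *: "exp (pi * \<bar>Im x0\<bar>) < pi * exp 1 * norm x0"
      using x0 by (simp add: saddle_region_def)
    have "norm (1 / x0 / (\<i> * (s * pi)) * exp (1 / (1 / x0 / (\<i> * (s * pi))))) =
        exp (- (s * pi * Im x0)) / (norm x0 * pi)"
      using that by (auto simp: norm_divide norm_mult)
    also have "\<dots> \<le> exp (pi * \<bar>Im x0\<bar>) / (norm x0 * pi)"
      using that by (intro divide_right_mono) (auto simp: abs_if)
    also have "\<dots> < exp 1" using * n0 by (simp add: divide_less_eq mult_ac)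
    finally show ?thesis ..
  qed
  have lim: "filterlim (\<lambda>p. (fst p, 1 / snd p)) (sequentially \<times>\<^sub>F nhds (1 / x0)) (sequentially \<times>\<^sub>F nhds x0)"
    by (intro filterlim_Pair filterlim_fst tendsto_divide tendsto_const filterlim_snd xnz)
  show "((\<lambda>p. \<Sum>m\<le>fst p. euler_coeff m * of_real (fall_ratio (fst p) m) * (1 / snd p) ^ m)
     \<longlongrightarrow> 2 / (exp (1 / x0) + 1)) (sequentially \<times>\<^sub>F nhds x0)"
    using filterlim_compose[OF saddle_sum_tendsto[OF y1 y2 s] lim] by simp
qed

lemma tendsto_power_locally:
  fixes f :: "'a \<Rightarrow> real"
  assumes "(f \<longlongrightarrow> L) G" "L < 1" "\<forall>\<^sub>F x in G. 0 \<le> f x"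
  shows "((\<lambda>p. f (snd p) ^ fst p) \<longlongrightarrow> 0) (sequentially \<times>\<^sub>F G)"
proof (rule Lim_null_comparison[OF _ tendsto_nat_times_power_locally[OF assms]])
  show "\<forall>\<^sub>F p in sequentially \<times>\<^sub>F G. norm (f (snd p) ^ fst p) \<le> real (fst p) * f (snd p) ^ fst p"
    using eventually_fst_pos eventually_compose_filterlim[OF assms(3) filterlim_snd]
    by eventually_elim (auto simp: mult_le_cancel_right1 Suc_le_eq)
qed

text \<open>The factors \<open>z^(n + 1)\<close> and \<open>exp (- n z x)\<close>, for
  \<open>z = s pi \<i>\<close>, normalise the contribution of the pole \<open>z\<close> to
  \<open>2\<close>. Everything else decays geometrically, uniformly near \<open>x0\<close>.\<close>

lemma pole_region_tendsto:
  assumes s: "s = 1 \<or> s = (-1 :: real)" and x0: "x0 \<in> pole_region s"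
  shows "((\<lambda>p. exp_conv euler_coeff (fst p) (snd p) * (\<i> * (s * pi)) ^ Suc (fst p) *
            exp (- (of_nat (fst p) * (\<i> * (s * pi) * snd p)))) \<longlongrightarrow> 2) (sequentially \<times>\<^sub>F nhds x0)"
    (is "(?q \<longlongrightarrow> _) ?F")
proof -
  define z where "z = \<i> * complex_of_real (s * pi)"
  have z: "norm z = pi" "z \<noteq> 0" using s by (auto simp: z_def norm_mult)
  define w where "w x = - (s * pi * Im x)" for x
  have Re: "Re (z * x) = w x" for x by (simp add: z_def w_def)
  have x0': "norm x0 < 1 / pi" "w x0 > 0" "pi * exp 1 * norm x0 < exp (w x0)" "x0 \<noteq> 0"
    using x0 s by (auto simp: pole_region_def w_def mult_less_0_iff)
  \<comment> \<open>Decay rates relative to the dominant pole: \<open>\<kappa>1\<close> for the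
    truncation remainders at both poles, \<open>\<kappa>2\<close> for the exponential at the
    opposite pole and, below, \<open>\<kappa>3\<close> for the far part.\<close>
  define \<kappa>1 where "\<kappa>1 x = exp 1 * (pi * norm x) * exp (- w x)" for x
  define \<kappa>2 where "\<kappa>2 x = exp (- 2 * w x)" for x
  have k12: "\<kappa>1 x0 < 1" "\<kappa>2 x0 < 1"
    using x0' by (simp_all add: \<kappa>1_def \<kappa>2_def exp_minus divide_simps mult_ac)
  \<comment> \<open>\<open>e\<^bsup>R|x|\<^esup> / R\<close> is minimal at \<open>R = 1/|x|\<close>; the cap \<open>\<pi>e\<close> keeps \<open>R\<close> below the radius \<open>3\<pi>\<close>.\<close>
  obtain R where R: "R > 0" "R < 3 * pi" "pi * exp (R * norm x0) * exp (- w x0) / R < 1"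
  proof (cases "norm x0 < 1 / (pi * exp 1)")
    case True
    have "pi * exp (pi * exp 1 * norm x0) * exp (- w x0) / (pi * exp 1) = exp (pi * exp 1 * norm x0 - 1 - w x0)"
      by (simp add: exp_diff exp_minus divide_simps)
    also have "\<dots> < 1"
      using True x0' by (simp add: less_divide_eq mult_ac)
    finally show ?thesis
      using e_less_272 by (intro that[of "pi * exp 1"]) auto
  next
    case False
    have "1 / norm x0 \<le> pi * exp 1"
      using False x0' by (simp add: divide_simps mult_ac)
    also have "\<dots> < 3 * pi" using e_less_272 by simp
    finally have "1 / norm x0 < 3 * pi" .
    moreover have "pi * exp (1 / norm x0 * norm x0) * exp (- w x0) / (1 / norm x0) = \<kappa>1 x0"
      using x0' by (simp add: \<kappa>1_def)
    ultimately show ?thesis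
      using x0' k12 by (intro that[of "1 / norm x0"]) auto
  qed
  define \<kappa>3 where "\<kappa>3 x = pi * exp (R * norm x) * exp (- w x) / R" for x
  define C where "C = (\<Sum>m. norm (euler_far_coeff m) * R ^ m)"
  define T where "T x = 2 / (1 - pi * norm x)" for x :: complex
  define E where "E p = C * pi * \<kappa>3 (snd p) ^ fst p + 2 * (\<kappa>1 (snd p) ^ fst p * T (snd p)) +
      2 * (\<kappa>2 (snd p) ^ fst p + \<kappa>1 (snd p) ^ fst p * T (snd p))" for p :: "nat \<times> complex"
  have sm: "summable (\<lambda>m. norm (euler_far_coeff m) * R ^ m)"
    using R by (intro euler_far_sums(2)[of 0]) auto
  have bound: "norm (exp_conv euler_coeff n x * z ^ Suc n * exp (- (of_nat n * (z * x))) - 2) \<le> E (n, x)"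
    if n: "n > 0" and x: "norm x < 1 / pi" for n x
  proof -
    define e where "e = exp (- (of_nat n * (z * x)))"
    have ne: "norm e = exp (- w x) ^ n"
      using Re[of x] by (simp add: e_def exp_of_nat_mult[symmetric])
    define S where "S u = (\<Sum>k\<le>n. (of_nat n * u) ^ k / fact k)" for u :: complex
    have zx: "norm (z * x) < 1" "norm (- z * x) < 1" "norm (z * x) = pi * norm x" "norm (- z * x) = pi * norm x"
      using z x by (auto simp: norm_mult less_divide_eq mult.commute)
    have "exp_conv euler_coeff n x = exp_conv euler_far_coeff n x +
       2 * (1 / z) ^ Suc n * S (z * x) + 2 * (1 / (- z)) ^ Suc n * S (- z * x)"
      unfolding exp_conv_euler_coeff[OF s] S_def z_def by simp
    moreover have "(A + 2 * B * s + 2 * D * t) * u * e =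
        A * u * e + 2 * (B * u) * (s * e) + 2 * (D * u) * (t * e)" for A B D s t u
      by (simp add: algebra_simps)
    ultimately have "exp_conv euler_coeff n x * z ^ Suc n * e =
       exp_conv euler_far_coeff n x * z ^ Suc n * e +
       2 * ((1 / z) ^ Suc n * z ^ Suc n) * (S (z * x) * e) + 2 * ((1 / (- z)) ^ Suc n * z ^ Suc n) * (S (- z * x) * e)"
      by (simp only:)
    also have "(1 / z) ^ Suc n * z ^ Suc n = 1"
      using z by (simp add: power_mult_distrib[symmetric] del: power_Suc)
    also have "(1 / (- z)) ^ Suc n * z ^ Suc n = (- 1) ^ Suc n"
      using z by (simp add: power_mult_distrib[symmetric] del: power_Suc)
    finally have eq: "exp_conv euler_coeff n x * z ^ Suc n * e - 2 =
       exp_conv euler_far_coeff n x * z ^ Suc n * e + 2 * (S (z * x) * e - 1) + 2 * (- 1) ^ Suc n * (S (- z * x) * e)"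
      by (simp add: algebra_simps)
    have k1: "(exp 1 * (pi * norm x)) ^ n * (2 / (1 - pi * norm x)) * norm e = \<kappa>1 x ^ n * T x"
      by (simp add: ne \<kappa>1_def T_def power_mult_distrib)
    have "norm (exp_conv euler_far_coeff n x * z ^ Suc n * e) \<le>
        C * (exp (R * norm x) / R) ^ n * pi ^ Suc n * exp (- w x) ^ n"
      unfolding norm_mult ne norm_power z C_def
      by (intro mult_right_mono norm_exp_conv_le R sm) auto
    also have "\<dots> = C * pi * \<kappa>3 x ^ n"
      by (simp add: \<kappa>3_def power_mult_distrib power_divide)
    finally have 1: "norm (exp_conv euler_far_coeff n x * z ^ Suc n * e) \<le> C * pi * \<kappa>3 x ^ n" .
    have "exp (of_nat n * (z * x)) * e = 1"
      by (simp add: e_def exp_minus)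
    then have "S (z * x) * e - 1 = - ((exp (of_nat n * (z * x)) - S (z * x)) * e)"
      by (simp add: left_diff_distrib)
    then have "norm (S (z * x) * e - 1) = norm (exp (of_nat n * (z * x)) - S (z * x)) * norm e"
      by (simp add: norm_mult)
    also have "\<dots> \<le> (exp 1 * (pi * norm x)) ^ n * (2 / (1 - pi * norm x)) * norm e"
      using norm_exp_remainder_le[OF n zx(1)] unfolding zx S_def by (intro mult_right_mono) auto
    finally have 2: "norm (S (z * x) * e - 1) \<le> \<kappa>1 x ^ n * T x"
      unfolding k1 .
    \<comment> \<open>At the opposite pole the exponential is \<open>e\<close> itself, so after
      normalisation it becomes \<open>e * e\<close>, of modulus
      \<open>\<kappa>2 x ^ n\<close>.\<close>
    have "exp (of_nat n * (- z * x)) = e"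
      by (simp add: e_def)
    then have "S (- z * x) * e = e * e - (exp (of_nat n * (- z * x)) - S (- z * x)) * e"
      by (simp add: left_diff_distrib)
    then have "norm (S (- z * x) * e) = norm (e * e - (exp (of_nat n * (- z * x)) - S (- z * x)) * e)"
      by (rule arg_cong)
    also have "\<dots> \<le> norm (e * e) + norm ((exp (of_nat n * (- z * x)) - S (- z * x)) * e)"
      by (rule norm_triangle_ineq4)
    also have "\<dots> = norm (e * e) + norm (exp (of_nat n * (- z * x)) - S (- z * x)) * norm e"
      by (simp only: norm_mult)
    also have "\<dots> \<le> norm (e * e) + (exp 1 * (pi * norm x)) ^ n * (2 / (1 - pi * norm x)) * norm e"
      using norm_exp_remainder_le[OF n zx(2)] unfolding zx S_def by (intro add_left_mono mult_right_mono) auto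
    also have "norm (e * e) = \<kappa>2 x ^ n"
      by (simp add: norm_mult ne \<kappa>2_def power_mult_distrib[symmetric] exp_add[symmetric])
    finally have 3: "norm (S (- z * x) * e) \<le> \<kappa>2 x ^ n + \<kappa>1 x ^ n * T x"
      unfolding k1 .
    have "norm (exp_conv euler_coeff n x * z ^ Suc n * e - 2) \<le>
        norm (exp_conv euler_far_coeff n x * z ^ Suc n * e) + norm (2 * (S (z * x) * e - 1)) +
        norm (2 * (- 1) ^ Suc n * (S (- z * x) * e))"
      unfolding eq by (intro order_trans[OF norm_triangle_ineq] add_right_mono norm_triangle_ineq)
    also have "\<dots> \<le> E (n, x)"
    proof -
      have "norm (2 * (S (z * x) * e - 1)) = 2 * norm (S (z * x) * e - 1)"
        by (simp only: norm_mult norm_numeral)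
      moreover have "norm (2 * (- 1) ^ Suc n * (S (- z * x) * e)) = 2 * norm (S (- z * x) * e)"
        by (simp add: norm_mult norm_power)
      ultimately show ?thesis
        using add_mono[OF add_mono[OF 1 mult_left_mono[OF 2, of 2]] mult_left_mono[OF 3, of 2]]
        unfolding E_def fst_conv snd_conv by (simp only: zero_le_numeral)
    qed
    finally show ?thesis by (simp add: e_def)
  qed
  have snd: "((\<lambda>p. snd p) \<longlongrightarrow> x0) ?F"
    by (rule filterlim_snd)
  have ev: "\<forall>\<^sub>F p in ?F. norm (snd p) < 1 / pi"
    by (rule order_tendstoD(2)[OF tendsto_norm[OF snd] x0'(1)])
  have "((\<lambda>p. ?q p - 2) \<longlongrightarrow> 0) ?F"
  proof (rule Lim_null_comparison)
    show "\<forall>\<^sub>F p in ?F. norm (?q p - 2) \<le> E p"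
      using ev eventually_fst_pos
    proof eventually_elim
      case (elim p)
      then show ?case
        using bound[of "fst p" "snd p"] by (simp add: z_def)
    qed
    have wlim: "(w \<longlongrightarrow> w x0) (nhds x0)"
      unfolding w_def by (intro tendsto_intros filterlim_ident)
    have k: "((\<lambda>p. \<kappa>1 (snd p) ^ fst p) \<longlongrightarrow> 0) ?F" "((\<lambda>p. \<kappa>2 (snd p) ^ fst p) \<longlongrightarrow> 0) ?F"
      "((\<lambda>p. \<kappa>3 (snd p) ^ fst p) \<longlongrightarrow> 0) ?F"
    proof -
      have lims: "(\<kappa>1 \<longlongrightarrow> \<kappa>1 x0) (nhds x0)" "(\<kappa>2 \<longlongrightarrow> \<kappa>2 x0) (nhds x0)" "(\<kappa>3 \<longlongrightarrow> \<kappa>3 x0) (nhds x0)"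
        unfolding \<kappa>1_def \<kappa>2_def \<kappa>3_def using R by (intro tendsto_intros filterlim_ident wlim; simp)+
      have pos: "\<forall>\<^sub>F x in nhds x0. 0 \<le> \<kappa>1 x" "\<forall>\<^sub>F x in nhds x0. 0 \<le> \<kappa>2 x"
          "\<forall>\<^sub>F x in nhds x0. 0 \<le> \<kappa>3 x"
        using R by (simp_all add: \<kappa>1_def \<kappa>2_def \<kappa>3_def)
      have k3: "\<kappa>3 x0 < 1" using R by (simp add: \<kappa>3_def)
      show "((\<lambda>p. \<kappa>1 (snd p) ^ fst p) \<longlongrightarrow> 0) ?F" "((\<lambda>p. \<kappa>2 (snd p) ^ fst p) \<longlongrightarrow> 0) ?F"
          "((\<lambda>p. \<kappa>3 (snd p) ^ fst p) \<longlongrightarrow> 0) ?F"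
        by (fact tendsto_power_locally[OF lims(1) k12(1) pos(1)] tendsto_power_locally[OF lims(2) k12(2) pos(2)]
            tendsto_power_locally[OF lims(3) k3 pos(3)])+
    qed
    have "1 - pi * norm x0 \<noteq> 0" using x0'(1) by (simp add: less_divide_eq mult.commute)
    then have "((\<lambda>p. T (snd p)) \<longlongrightarrow> T x0) ?F"
      unfolding T_def by (intro tendsto_divide tendsto_diff tendsto_const tendsto_mult tendsto_norm snd)
    then have "(E \<longlongrightarrow> C * pi * 0 + 2 * (0 * T x0) + 2 * (0 + 0 * T x0)) ?F"
      unfolding E_def by (intro tendsto_add tendsto_mult tendsto_const k)
    then show "(E \<longlongrightarrow> 0) ?F" by simp
  qed
  then have "((\<lambda>p. (?q p - 2) + 2) \<longlongrightarrow> 0 + 2) ?F"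
    by (intro tendsto_add tendsto_const)
  then show ?thesis by simp
qed

section \<open>Zeros accumulate only at the attractor\<close>

lemma eventually_nonzero_saddle_region:
  assumes "x0 \<in> saddle_region"
  shows "\<forall>\<^sub>F p in sequentially \<times>\<^sub>F nhds x0. exp_conv euler_coeff (fst p) (snd p) \<noteq> 0"
proof -
  have "exp (1 / x0) + 1 \<noteq> 0"
    using saddle_region_tendsto(3)[OF assms] by (simp add: add_eq_0_iff2)
  then have "2 / (exp (1 / x0) + 1) \<noteq> 0" by simp
  from tendsto_imp_eventually_ne[OF saddle_region_tendsto(1)[OF assms] this]
  have "\<forall>\<^sub>F p in sequentially \<times>\<^sub>F nhds x0.
    (\<Sum>m\<le>fst p. euler_coeff m * of_real (fall_ratio (fst p) m) * (1 / snd p) ^ m) \<noteq> 0" .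
  moreover have "\<forall>\<^sub>F p in sequentially \<times>\<^sub>F nhds x0. snd p \<noteq> 0"
    by (rule tendsto_imp_eventually_ne[OF filterlim_snd saddle_region_tendsto(2)[OF assms]])
  ultimately show ?thesis
    using eventually_fst_pos by eventually_elim (simp add: exp_conv_eq_fall_ratio)
qed

lemma eventually_nonzero_pole_region:
  assumes "s = 1 \<or> s = (-1 :: real)" "x0 \<in> pole_region s"
  shows "\<forall>\<^sub>F p in sequentially \<times>\<^sub>F nhds x0. exp_conv euler_coeff (fst p) (snd p) \<noteq> 0"
  using tendsto_imp_eventually_ne[OF pole_region_tendsto[OF assms], of 0]
  by (rule eventually_mono) auto

text \<open>Compactness needs one disc containing all zeros for large \<open>n\<close>. In the
  variable \<open>y = 1 / x\<close> this is the saddle asymptotics at \<open>y = 0\<close>, where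
  the limit is \<open>1\<close>.\<close>

lemma nonzero_near_infinity:
  obtains r N where "r > 0" "\<And>n x. n \<ge> N \<Longrightarrow> norm x > r \<Longrightarrow> exp_conv euler_coeff n x \<noteq> 0"
proof -
  have "((\<lambda>p. \<Sum>m\<le>fst p. euler_coeff m * of_real (fall_ratio (fst p) m) * snd p ^ m)
     \<longlongrightarrow> 2 / (exp 0 + 1)) (sequentially \<times>\<^sub>F nhds 0)"
    by (rule saddle_sum_tendsto) auto
  then have "\<forall>\<^sub>F p in sequentially \<times>\<^sub>F nhds 0.
      (\<Sum>m\<le>fst p. euler_coeff m * of_real (fall_ratio (fst p) m) * snd p ^ m) \<noteq> 0"
    by (rule tendsto_imp_eventually_ne) simp
  then obtain P Q where P: "eventually P sequentially" and Q: "eventually Q (nhds 0)"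
    and PQ: "\<And>n y. P n \<Longrightarrow> Q y \<Longrightarrow> (\<Sum>m\<le>n. euler_coeff m * of_real (fall_ratio n m) * y ^ m) \<noteq> 0"
    unfolding eventually_prod_filter by auto
  from P obtain N where N: "\<And>n. n \<ge> N \<Longrightarrow> P n" unfolding eventually_sequentially by blast
  from Q obtain d where d: "d > 0" "\<And>y. norm y < d \<Longrightarrow> Q y"
    unfolding eventually_nhds_metric by auto
  show ?thesis
  proof (rule that[of "1 / d" "max 1 N"])
    fix n and x :: complex assume n: "max 1 N \<le> n" and x: "1 / d < norm x"
    then have "norm x > 0" using d by (meson divide_pos_pos less_trans zero_less_one)
    then have "x \<noteq> 0" "norm (1 / x) < d" using x d by (auto simp: norm_divide field_simps)
    then show "exp_conv euler_coeff n x \<noteq> 0"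
      using PQ[OF N d(2), of n "1 / x"] n by (simp add: exp_conv_eq_fall_ratio)
  qed (use d in auto)
qed

lemma norm_pole_condition:
  fixes s :: real
  shows "norm (s * pi * \<i> * x * exp (1 - s * pi * \<i> * x)) = \<bar>s\<bar> * (pi * exp 1 * norm x) * exp (s * pi * Im x)"
  by (simp add: norm_mult exp_add)

text \<open>The two curves share one description with a sign \<open>s\<close>, in which they are the
  equality case of the inequality defining \<open>pole_region s\<close>.\<close>

lemma mem_euler_attractor_set_iff:
  "x \<in> euler_attractor_set \<longleftrightarrow>
     (Im x = 0 \<and> pi * exp 1 * norm x \<le> 1) \<or>
     (\<exists>s. (s = 1 \<or> s = -1) \<and> norm x \<le> 1 / pi \<and> s * Im x \<le> 0 \<and> pi * exp 1 * norm x = exp (- s * pi * Im x))"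
proof -
  have "x \<in> complex_of_real ` {- 1 / (pi * exp 1)..1 / (pi * exp 1)} \<longleftrightarrow> Im x = 0 \<and> pi * exp 1 * norm x \<le> 1"
  proof -
    have "x \<in> complex_of_real ` {- 1 / (pi * exp 1)..1 / (pi * exp 1)} \<longleftrightarrow>
        Im x = 0 \<and> \<bar>Re x\<bar> \<le> 1 / (pi * exp 1)"
      by (auto simp: image_iff complex_eq_iff abs_le_iff)
    moreover have "norm x = \<bar>Re x\<bar>" if "Im x = 0"
      using that by (simp add: cmod_def)
    ultimately show ?thesis by (auto simp: le_divide_eq mult_ac)
  qed
  moreover have "norm (s * pi * \<i> * x * exp (1 - s * pi * \<i> * x)) = 1 \<longleftrightarrow>
      pi * exp 1 * norm x = exp (- s * pi * Im x)" if "s = 1 \<or> s = -1" for s :: real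
    using that unfolding norm_pole_condition by (auto simp: exp_minus field_simps)
  from this[of 1] this[of "-1"] have
    "norm (of_real pi * \<i> * x * exp (1 - of_real pi * \<i> * x)) = 1 \<longleftrightarrow> pi * exp 1 * norm x = exp (- 1 * pi * Im x)"
    "norm (- of_real pi * \<i> * x * exp (1 + of_real pi * \<i> * x)) = 1 \<longleftrightarrow> pi * exp 1 * norm x = exp (- (-1) * pi * Im x)"
    by simp_all
  ultimately show ?thesis
    unfolding euler_attractor_set_def Un_iff mem_Collect_eq by (auto simp del: norm_minus_cancel)
qed

text \<open>Off the saddle region, comparison of \<open>pi e |x|\<close> with
  \<open>exp (pi |Im x|)\<close> leaves equality, which gives a point of a curve or of the segment,
  or strict inequality, which gives a pole region or, on the real axis, the segment.\<close>

lemma region_cases: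
  assumes "x \<notin> euler_attractor_set"
  shows "x \<in> saddle_region \<or> (\<exists>s. (s = 1 \<or> s = -1) \<and> x \<in> pole_region s)"
proof (rule disjCI)
  assume nP: "\<nexists>s. (s = 1 \<or> s = -1) \<and> x \<in> pole_region s"
  show "x \<in> saddle_region"
  proof (rule ccontr)
    assume "x \<notin> saddle_region"
    then have nx: "norm x \<le> 1 / pi" "pi * exp 1 * norm x \<le> exp (pi * \<bar>Im x\<bar>)"
      by (auto simp: saddle_region_def)
    show False
    proof (cases "Im x = 0")
      case True
      then show False using nx assms by (simp add: mem_euler_attractor_set_iff)
    next
      case False
      \<comment> \<open>The sign for which \<open>s * Im x < 0\<close>; it picks the larger of the
        two pole rates.\<close>
      define s :: real where "s = (if Im x < 0 then 1 else -1)"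
      have s: "s = 1 \<or> s = -1" "s * Im x < 0" "\<bar>Im x\<bar> = - s * Im x"
        using False by (auto simp: s_def)
      have e: "exp (pi * \<bar>Im x\<bar>) = exp (- s * pi * Im x)"
        using s(3) by (simp add: mult_ac)
      have "pi * exp 1 * norm x \<noteq> exp (- s * pi * Im x)"
      proof
        assume eq: "pi * exp 1 * norm x = exp (- s * pi * Im x)"
        have "x \<in> euler_attractor_set"
          unfolding mem_euler_attractor_set_iff
          by (intro disjI2 exI[of _ s] conjI s(1) nx(1) eq less_imp_le[OF s(2)])
        with assms show False by contradiction
      qed
      with nx(2) have lt: "pi * exp 1 * norm x < exp (- s * pi * Im x)"
        unfolding e by simp
      \<comment> \<open>On this circle strict dominance of the pole would force
        \<open>|Im x| > 1 / pi = |x|\<close>.\<close>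
      have "norm x \<noteq> 1 / pi"
      proof
        assume eq: "norm x = 1 / pi"
        have "exp 1 < exp (pi * \<bar>Im x\<bar>)" using lt unfolding e eq by simp
        then have "1 < pi * \<bar>Im x\<bar>" by simp
        also have "\<dots> \<le> pi * norm x" using abs_Im_le_cmod[of x] by simp
        finally show False using eq by simp
      qed
      with nx(1) s lt have "x \<in> pole_region s" by (simp add: pole_region_def)
      with nP s show False by blast
    qed
  qed
qed

lemma zeros_near_attractor:
  assumes "\<epsilon> > 0"
  shows "\<exists>N. \<forall>n\<ge>N. \<forall>z. exp_conv euler_coeff n z = 0 \<longrightarrow> z \<in> (\<Union>x\<in>euler_attractor_set. ball x \<epsilon>)"
proof -
  obtain r N0 where r: "\<And>n x. n \<ge> N0 \<Longrightarrow> norm x > r \<Longrightarrow> exp_conv euler_coeff n x \<noteq> 0"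
    by (rule nonzero_near_infinity) (rule that)
  define C where "C = cball 0 r - (\<Union>x\<in>euler_attractor_set. ball x \<epsilon>)"
  have "compact C"
    unfolding C_def by (intro compact_diff compact_cball open_UN ballI open_ball)
  have "\<exists>d N. d > 0 \<and> (\<forall>n\<ge>N. \<forall>z\<in>ball x d. exp_conv euler_coeff n z \<noteq> 0)" if "x \<in> C" for x
  proof -
    have "x \<notin> euler_attractor_set"
      using that assms centre_in_ball[of x \<epsilon>] unfolding C_def by blast
    then have "\<forall>\<^sub>F p in sequentially \<times>\<^sub>F nhds x. exp_conv euler_coeff (fst p) (snd p) \<noteq> 0"
      using region_cases eventually_nonzero_saddle_region eventually_nonzero_pole_region by blast
    then obtain P Q where P: "eventually P sequentially" and Q: "eventually Q (nhds x)"
      and PQ: "\<And>n y. P n \<Longrightarrow> Q y \<Longrightarrow> exp_conv euler_coeff n y \<noteq> 0"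
      unfolding eventually_prod_filter by auto
    from P obtain N where "\<And>n. n \<ge> N \<Longrightarrow> P n" unfolding eventually_sequentially by blast
    moreover from Q obtain d where "d > 0" "\<And>y. dist y x < d \<Longrightarrow> Q y"
      unfolding eventually_nhds_metric by auto
    ultimately show ?thesis
      using PQ by (intro exI[of _ d] exI[of _ N]) (auto simp: dist_commute)
  qed
  then obtain d N where dN: "\<And>x. x \<in> C \<Longrightarrow> d x > 0"
    "\<And>x n z. x \<in> C \<Longrightarrow> n \<ge> N x \<Longrightarrow> z \<in> ball x (d x) \<Longrightarrow> exp_conv euler_coeff n z \<noteq> 0"
    by metis
  have "C \<subseteq> (\<Union>x\<in>C. ball x (d x))" using dN(1) by force
  then obtain F where F: "F \<subseteq> C" "finite F" "C \<subseteq> (\<Union>x\<in>F. ball x (d x))"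
    using compactE_image[OF \<open>compact C\<close>, of C "\<lambda>x. ball x (d x)"] by auto
  define N1 where "N1 = Max (insert N0 (N ` F))"
  have N1: "N0 \<le> N1" "\<And>x. x \<in> F \<Longrightarrow> N x \<le> N1"
    unfolding N1_def using F(2) by auto
  show ?thesis
  proof (intro exI[of _ N1] allI impI)
    fix n z assume n: "N1 \<le> n" and z: "exp_conv euler_coeff n z = 0"
    show "z \<in> (\<Union>x\<in>euler_attractor_set. ball x \<epsilon>)"
    proof (rule ccontr)
      assume "z \<notin> (\<Union>x\<in>euler_attractor_set. ball x \<epsilon>)"
      moreover have "norm z \<le> r" using r[of n z] z n N1(1) by force
      ultimately have "z \<in> C" unfolding C_def by simp
      then obtain x where x: "x \<in> F" "z \<in> ball x (d x)" using F(3) by blast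
      then show False using dN(2)[of x n z] F(1) N1(2)[of x] n z by auto
    qed
  qed
qed

section \<open>Every point of the attractor is a limit of zeros\<close>

lemma root_tendsto_1:
  fixes t :: "nat \<Rightarrow> real"
  assumes "c > 0" "\<forall>\<^sub>F n in sequentially. c / n \<le> t n" "\<forall>\<^sub>F n in sequentially. t n \<le> C"
  shows "(\<lambda>n. root n (t n)) \<longlonglongrightarrow> 1"
proof (rule tendsto_sandwich)
  have "\<forall>\<^sub>F n in sequentially. 0 < C"
    using assms(2,3) eventually_gt_at_top[of 0]
  proof eventually_elim
    case (elim n)
    then have "0 < c / n" using assms(1) by simp
    with elim show ?case by linarith
  qed
  then have C: "C > 0" by simp
  show "\<forall>\<^sub>F n in sequentially. root n (c / n) \<le> root n (t n)"
    using assms(2) eventually_gt_at_top[of 0] by eventually_elim simp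
  show "\<forall>\<^sub>F n in sequentially. root n (t n) \<le> root n C"
    using assms(3) eventually_gt_at_top[of 0] by eventually_elim simp
  show "(\<lambda>n. root n C) \<longlonglongrightarrow> 1"
    by (rule LIMSEQ_root_const[OF C])
  \<comment> \<open>The factor \<open>1 / n\<close> in the lower bound, which leaves room for the
    loss in \<open>fact_div_power_self_le\<close>, is harmless because \<open>root n n\<close> tends
    to \<open>1\<close>.\<close>
  have "(\<lambda>n. root n c / root n n) \<longlonglongrightarrow> 1 / 1"
    by (intro tendsto_divide LIMSEQ_root_const LIMSEQ_root assms(1)) auto
  then show "(\<lambda>n. root n (c / n)) \<longlonglongrightarrow> 1"
    by (simp add: real_root_divide)
qed

lemma root_mult_power_tendsto:
  fixes t :: "nat \<Rightarrow> real"
  assumes "(\<lambda>n. root n (t n)) \<longlonglongrightarrow> 1" "a \<ge> 0"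
  shows "(\<lambda>n. root n (t n * a ^ n)) \<longlonglongrightarrow> a"
proof -
  have "(\<lambda>n. root n (t n) * a) \<longlonglongrightarrow> 1 * a"
    by (intro tendsto_mult assms tendsto_const)
  moreover have "\<forall>\<^sub>F n in sequentially. root n (t n * a ^ n) = root n (t n) * a"
    using eventually_gt_at_top[of 0]
    by eventually_elim (simp add: real_root_mult real_root_power_cancel assms(2))
  ultimately show ?thesis by (simp add: tendsto_cong)
qed

lemma root_tendsto_1_of_limit:
  fixes t :: "nat \<Rightarrow> real"
  assumes "t \<longlonglongrightarrow> L" "L > 0"
  shows "\<forall>\<^sub>F n in sequentially. L / 2 \<le> t n" "\<forall>\<^sub>F n in sequentially. t n \<le> 2 * L"
    "(\<lambda>n. root n (t n)) \<longlonglongrightarrow> 1"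
proof -
  show lower: "\<forall>\<^sub>F n in sequentially. L / 2 \<le> t n"
    using order_tendstoD(1)[OF assms(1), of "L / 2"] assms(2) by (auto elim: eventually_mono)
  show upper: "\<forall>\<^sub>F n in sequentially. t n \<le> 2 * L"
    using order_tendstoD(2)[OF assms(1), of "2 * L"] assms(2) by (auto elim: eventually_mono)
  have "\<forall>\<^sub>F n in sequentially. (L / 2) / n \<le> t n"
    using lower eventually_gt_at_top[of 0]
  proof eventually_elim
    case (elim n)
    have "(L / 2) / n \<le> (L / 2) / 1" using elim assms(2) by (intro divide_left_mono) auto
    with elim show ?case by simp
  qed
  then show "(\<lambda>n. root n (t n)) \<longlonglongrightarrow> 1"
    using upper assms(2) by (intro root_tendsto_1[of "L / 2" t "2 * L"]) auto
qed

lemma filterlim_Pair_const: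
  "filterlim (\<lambda>n. (n, x)) (sequentially \<times>\<^sub>F nhds x) sequentially"
  by (intro filterlim_Pair filterlim_ident tendsto_const)

lemma root_tendsto_pole_region:
  assumes s: "s = 1 \<or> s = (-1 :: real)" and x: "x \<in> pole_region s"
  shows "(\<lambda>n. root n (norm (exp_conv euler_coeff n x))) \<longlonglongrightarrow> exp (- s * pi * Im x) / pi"
proof -
  define t where "t n = norm (exp_conv euler_coeff n x * (\<i> * (s * pi)) ^ Suc n *
            exp (- (of_nat n * (\<i> * (s * pi) * x))))" for n
  have "(\<lambda>n. exp_conv euler_coeff n x * (\<i> * (s * pi)) ^ Suc n *
            exp (- (of_nat n * (\<i> * (s * pi) * x)))) \<longlonglongrightarrow> 2"
    using filterlim_compose[OF pole_region_tendsto[OF s x] filterlim_Pair_const] by simp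
  from tendsto_norm[OF this] have "t \<longlonglongrightarrow> 2" unfolding t_def by simp
  then have "(\<lambda>n. t n / pi) \<longlonglongrightarrow> 2 / pi" by (intro tendsto_divide tendsto_const) auto
  then have "(\<lambda>n. root n (t n / pi * (exp (- s * pi * Im x) / pi) ^ n)) \<longlonglongrightarrow> exp (- s * pi * Im x) / pi"
    by (intro root_mult_power_tendsto root_tendsto_1_of_limit(3)) auto
  moreover have "t n / pi * (exp (- s * pi * Im x) / pi) ^ n = norm (exp_conv euler_coeff n x)" for n
  proof -
    have "norm (\<i> * (s * pi)) = pi" using s by (auto simp: norm_mult)
    then have "t n = norm (exp_conv euler_coeff n x) * pi ^ Suc n * exp (real n * (s * pi * Im x))"
      by (simp add: t_def norm_mult norm_power)
    moreover have "exp (- s * pi * Im x) ^ n = exp (- (real n * (s * pi * Im x)))"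
      by (simp add: exp_of_nat_mult[symmetric])
    ultimately show ?thesis
      by (simp add: power_divide exp_minus)
  qed
  ultimately show ?thesis by simp
qed

lemma root_tendsto_saddle_region:
  assumes x: "x \<in> saddle_region"
  shows "(\<lambda>n. root n (norm (exp_conv euler_coeff n x))) \<longlonglongrightarrow> exp 1 * norm x"
proof -
  define S where "S n = norm (\<Sum>m\<le>n. euler_coeff m * of_real (fall_ratio n m) * (1 / x) ^ m)" for n
  \<comment> \<open>The Stirling factor, which lies between \<open>1 / (e n)\<close> and
    \<open>1\<close> for \<open>n > 0\<close>.\<close>
  define u where "u n = real n ^ n / fact n / exp 1 ^ n" for n
  define L where "L = norm (2 / (exp (1 / x) + 1))"
  have "exp (1 / x) + 1 \<noteq> 0"
    using saddle_region_tendsto(3)[OF x] by (simp add: add_eq_0_iff2)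
  then have L: "L > 0" by (simp add: L_def)
  have "(\<lambda>n. \<Sum>m\<le>n. euler_coeff m * of_real (fall_ratio n m) * (1 / x) ^ m) \<longlonglongrightarrow> 2 / (exp (1 / x) + 1)"
    using filterlim_compose[OF saddle_region_tendsto(1)[OF x] filterlim_Pair_const] by simp
  then have S: "S \<longlonglongrightarrow> L" unfolding S_def L_def by (rule tendsto_norm)
  have u1: "u n \<le> 1" "0 \<le> u n" for n
    using power_self_div_fact_le[of n] by (auto simp: u_def divide_le_eq mult.commute)
  have u2: "1 / exp 1 / n \<le> u n" if "n > 0" for n
  proof -
    have "1 / (exp 1 * n * (1 / exp 1) ^ n) \<le> 1 / (fact n / real n ^ n)"
      using that fact_div_power_self_le[OF that] by (intro divide_left_mono) auto
    then have "1 / (exp 1 * n * (1 / exp 1) ^ n) / exp 1 ^ n \<le> 1 / (fact n / real n ^ n) / exp 1 ^ n"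
      by (intro divide_right_mono) auto
    then show ?thesis by (simp add: u_def power_divide)
  qed
  have "(\<lambda>n. root n (S n * u n)) \<longlonglongrightarrow> 1"
  proof (rule root_tendsto_1)
    show "L / 2 * (1 / exp 1) > 0" using L by simp
    show "\<forall>\<^sub>F n in sequentially. L / 2 * (1 / exp 1) / n \<le> S n * u n"
      using root_tendsto_1_of_limit(1)[OF S L] eventually_gt_at_top[of 0]
    proof eventually_elim
      case (elim n)
      have "L / 2 * (1 / exp 1 / n) \<le> S n * u n"
        using elim L u2[of n] u1 by (intro mult_mono) auto
      then show ?case by simp
    qed
    show "\<forall>\<^sub>F n in sequentially. S n * u n \<le> 2 * L"
      using root_tendsto_1_of_limit(2)[OF S L]
    proof eventually_elim
      case (elim n)
      have "S n * u n \<le> 2 * L * 1"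
        using elim u1 L by (intro mult_mono) auto
      then show ?case by simp
    qed
  qed
  then have "(\<lambda>n. root n (S n * u n * (exp 1 * norm x) ^ n)) \<longlonglongrightarrow> exp 1 * norm x"
    by (intro root_mult_power_tendsto) auto
  moreover have "\<forall>\<^sub>F n in sequentially. root n (S n * u n * (exp 1 * norm x) ^ n) = root n (norm (exp_conv euler_coeff n x))"
    using eventually_gt_at_top[of 0]
  proof eventually_elim
    case (elim n)
    have "norm (exp_conv euler_coeff n x) = (real n * norm x) ^ n / fact n * S n"
      using exp_conv_eq_fall_ratio[OF elim saddle_region_tendsto(2)[OF x], of euler_coeff]
      by (simp add: S_def norm_mult norm_divide norm_power)
    then show ?case by (simp add: u_def power_mult_distrib mult_ac)
  qed
  ultimately show ?thesis by (simp add: tendsto_cong)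
qed

text \<open>Radius \<open>1\<close> lies inside the disc of convergence since \<open>pi > 1\<close>.
  It makes \<open>norm_exp_conv_le\<close> with \<open>R = 1\<close> a bound on \<open>n\<close>-th
  roots valid for every \<open>x\<close>.\<close>

lemma euler_coeff_summable: "summable (\<lambda>m. norm (euler_coeff m))"
proof (rule summable_comparison_test')
  have "summable (\<lambda>m. norm (euler_far_coeff m) * 1 ^ m)"
    using pi_gt3 by (intro euler_far_sums(2)[of 0]) auto
  moreover have "summable (\<lambda>m. 4 / pi * (1 / pi) ^ m)"
    using pi_gt3 by (intro summable_mult summable_geometric) auto
  ultimately show "summable (\<lambda>m. norm (euler_far_coeff m) + 4 / pi * (1 / pi) ^ m)"
    by (intro summable_add) auto
  fix m :: nat
  have "norm (euler_coeff m) = norm (euler_far_coeff m + (2 * (1 / (\<i> * pi)) ^ Suc m + 2 * (1 / (- (\<i> * pi))) ^ Suc m))"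
    by (simp add: euler_far_coeff_def)
  also have "\<dots> \<le> norm (euler_far_coeff m) + (norm (2 * (1 / (\<i> * pi)) ^ Suc m) + norm (2 * (1 / (- (\<i> * pi))) ^ Suc m))"
    by (intro order_trans[OF norm_triangle_ineq] add_left_mono norm_triangle_ineq)
  also have "\<dots> = norm (euler_far_coeff m) + 4 / pi * (1 / pi) ^ m"
    by (simp add: norm_mult norm_divide norm_power power_divide)
  finally show "norm (norm (euler_coeff m)) \<le> norm (euler_far_coeff m) + 4 / pi * (1 / pi) ^ m"
    by simp
qed

section \<open>The normal family argument for discs without zeros\<close>

lemma holomorphic_exp_conv: "exp_conv \<beta> n holomorphic_on S"
  unfolding exp_conv_def[abs_def] by (intro holomorphic_intros) auto

lemma open_pole_region: "open (pole_region s)"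
proof -
  have "pole_region s = {x. norm x < 1 / pi} \<inter> {x. s * Im x < 0} \<inter>
      {x. pi * exp 1 * norm x < exp (- s * pi * Im x)}"
    by (auto simp: pole_region_def)
  also have "open \<dots>"
    by (intro open_Int open_Collect_less continuous_intros)
  finally show ?thesis .
qed

text \<open>By the open mapping theorem a nonconstant \<open>f\<close> would send \<open>U\<close>
  to an open set, but a subset of the unit circle contains no disc.\<close>

lemma holomorphic_unimodular_constant:
  assumes "f holomorphic_on S" "open S" "connected S" "open U" "U \<subseteq> S" "U \<noteq> {}"
    and "\<And>x. x \<in> U \<Longrightarrow> norm (f x) = 1"
  shows "f constant_on S"
proof (rule ccontr)
  assume "\<not> f constant_on S"
  then have op: "open (f ` U)"
    by (intro open_mapping_thm[OF assms(1-5)])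
  obtain x where x: "x \<in> U" using assms(6) by blast
  then obtain e where e: "e > 0" "ball (f x) e \<subseteq> f ` U"
    using op openE by blast
  define y where "y = (1 + of_real (e / 2)) * f x"
  have fx: "norm (f x) = 1" using assms(7) x by blast
  have "dist (f x) y = norm (of_real (e / 2) * f x)"
    by (simp add: y_def dist_norm distrib_right norm_minus_commute)
  then have "y \<in> ball (f x) e" using e fx by (simp add: norm_mult)
  then have "norm y = 1" using e assms(7) by auto
  moreover have "norm y = \<bar>1 + e / 2\<bar>"
    unfolding y_def norm_mult fx by (metis mult.right_neutral norm_of_real of_real_1 of_real_add)
  ultimately show False using e by simp
qed

text \<open>The competing contribution enters only through the limit \<open>L\<close> at one point
  \<open>x1\<close>. Hence the same argument serves the segment, where the competitor is the other
  pole, and the curves, where it is the saddle point.\<close>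

lemma zero_in_ball:
  assumes s: "s = 1 \<or> s = (-1 :: real)" and U: "ball x0 \<epsilon> \<inter> pole_region s \<noteq> {}"
    and x1: "x1 \<in> ball x0 \<epsilon>" and lim: "(\<lambda>n. root n (norm (exp_conv euler_coeff n x1))) \<longlonglongrightarrow> L"
    and L: "L \<noteq> exp (- s * pi * Im x1) / pi"
  shows "\<exists>n r. exp_conv euler_coeff n r = 0 \<and> r \<in> ball x0 \<epsilon>"
proof (rule ccontr)
  assume "\<nexists>n r. exp_conv euler_coeff n r = 0 \<and> r \<in> ball x0 \<epsilon>"
  then have nz: "exp_conv euler_coeff n x \<noteq> 0" if "x \<in> ball x0 \<epsilon>" for n x using that by blast
  have "\<exists>g. g holomorphic_on ball x0 \<epsilon> \<and> (\<forall>z\<in>ball x0 \<epsilon>. exp_conv euler_coeff n z = exp (g z))" for n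
    using contractible_imp_holomorphic_log[OF holomorphic_exp_conv[of euler_coeff n "ball x0 \<epsilon>"]
      convex_imp_contractible[OF convex_ball]] nz by metis
  then obtain g where g: "\<And>n. g n holomorphic_on ball x0 \<epsilon>"
    "\<And>n z. z \<in> ball x0 \<epsilon> \<Longrightarrow> exp_conv euler_coeff n z = exp (g n z)"
    by metis
  \<comment> \<open>A holomorphic root of order \<open>Suc n\<close>; the shift avoids the root of
    order \<open>0\<close>.\<close>
  define h where "h n z = exp (g (Suc n) z / of_nat (Suc n))" for n z
  have hroot: "norm (h n z) = root (Suc n) (norm (exp_conv euler_coeff (Suc n) z))" if "z \<in> ball x0 \<epsilon>" for n z
  proof -
    have "h n z ^ Suc n = exp_conv euler_coeff (Suc n) z"
      using g(2)[OF that] by (simp add: h_def exp_of_nat_mult[symmetric] del: power_Suc of_nat_Suc)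
    then show ?thesis
      by (metis norm_power norm_ge_zero real_root_power_cancel zero_less_Suc)
  qed
  \<comment> \<open>The value is at least \<open>1\<close>, so that \<open>C \<le> C ^ Suc n\<close>
    and the root of the bound can be taken.\<close>
  define C where "C = max 1 (\<Sum>m. norm (euler_coeff m) * 1 ^ m)"
  have hbound: "norm (h n z) \<le> C * exp (norm z)" if "z \<in> ball x0 \<epsilon>" for n z
  proof -
    have "norm (exp_conv euler_coeff (Suc n) z) \<le> (\<Sum>m. norm (euler_coeff m) * 1 ^ m) * (exp (1 * norm z) / 1) ^ Suc n"
      by (rule norm_exp_conv_le) (use euler_coeff_summable in auto)
    also have "\<dots> \<le> C * exp (norm z) ^ Suc n"
      by (intro mult_mono) (auto simp: C_def)
    also have "\<dots> \<le> C ^ Suc n * exp (norm z) ^ Suc n"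
      by (intro mult_right_mono self_le_power) (auto simp: C_def)
    also have "\<dots> = (C * exp (norm z)) ^ Suc n"
      by (simp add: power_mult_distrib)
    finally have "root (Suc n) (norm (exp_conv euler_coeff (Suc n) z)) \<le> root (Suc n) ((C * exp (norm z)) ^ Suc n)"
      by (intro real_root_le_mono) auto
    also have "\<dots> = C * exp (norm z)"
      by (intro real_root_power_cancel) (auto simp: C_def)
    finally show ?thesis unfolding hroot[OF that] .
  qed
  obtain G r where G: "G holomorphic_on ball x0 \<epsilon>" "strict_mono (r :: nat \<Rightarrow> nat)"
    "\<And>x. x \<in> ball x0 \<epsilon> \<Longrightarrow> (\<lambda>n. h (r n) x) \<longlonglongrightarrow> G x"
  proof (rule Montel[of "ball x0 \<epsilon>" "range h" h])
    show "f holomorphic_on ball x0 \<epsilon>" if "f \<in> range h" for f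
      using that g(1) unfolding h_def by (auto intro!: holomorphic_intros)
    show "\<exists>B. \<forall>f\<in>range h. \<forall>z\<in>K. norm (f z) \<le> B" if K: "compact K" "K \<subseteq> ball x0 \<epsilon>" for K
    proof -
      obtain B where B: "\<And>z. z \<in> K \<Longrightarrow> norm z \<le> B"
        using compact_imp_bounded[OF K(1)] unfolding bounded_iff by blast
      have "norm (h n z) \<le> C * exp B" if "z \<in> K" for n z
      proof -
        have "norm (h n z) \<le> C * exp (norm z)" using hbound that \<open>K \<subseteq> ball x0 \<epsilon>\<close> by blast
        also have "\<dots> \<le> C * exp B" using B[OF that] by (intro mult_left_mono) (auto simp: C_def)
        finally show ?thesis .
      qed
      then show ?thesis by blast
    qed
  qed (use that in auto)
  have normG: "norm (G x) = l" if "x \<in> ball x0 \<epsilon>" "(\<lambda>n. root n (norm (exp_conv euler_coeff n x))) \<longlonglongrightarrow> l" for x l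
  proof (rule LIMSEQ_unique)
    show "(\<lambda>n. norm (h (r n) x)) \<longlonglongrightarrow> norm (G x)"
      by (intro tendsto_norm G that)
    have "(\<lambda>n. norm (h n x)) \<longlonglongrightarrow> l"
      unfolding hroot[OF that(1)] by (rule LIMSEQ_Suc[OF that(2)])
    then show "(\<lambda>n. norm (h (r n) x)) \<longlonglongrightarrow> l"
      using LIMSEQ_subseq_LIMSEQ[OF _ G(2)] by (simp add: o_def)
  qed
  \<comment> \<open>The divisor is holomorphic without zeros, and its modulus is the growth rate of
    the pole \<open>s pi \<i>\<close>. So \<open>k\<close> is unimodular on the part of the pole
    region in the disc.\<close>
  define k where "k z = G z / (exp (\<i> * (s * pi) * z) / pi)" for z
  have normk: "norm (k z) = norm (G z) / (exp (- s * pi * Im z) / pi)" for z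
    by (simp add: k_def norm_divide norm_mult)
  have "k constant_on ball x0 \<epsilon>"
  proof (rule holomorphic_unimodular_constant)
    show "k holomorphic_on ball x0 \<epsilon>"
      unfolding k_def by (intro holomorphic_intros G) auto
    show "norm (k x) = 1" if "x \<in> ball x0 \<epsilon> \<inter> pole_region s" for x
      using normG[of x, OF _ root_tendsto_pole_region[OF s]] that unfolding normk by simp
  qed (use U open_pole_region in auto)
  moreover obtain u where u: "u \<in> ball x0 \<epsilon>" "u \<in> pole_region s" using U by blast
  ultimately have "k x1 = k u" using x1 unfolding constant_on_def by metis
  moreover have "norm (k u) = 1"
    using normG[OF u(1) root_tendsto_pole_region[OF s u(2)]] unfolding normk by simp
  ultimately have "norm (k x1) = 1" by simp
  then have "L = exp (- s * pi * Im x1) / pi"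
    unfolding normk normG[OF x1 lim] by (simp add: divide_simps)
  with L show False by simp
qed

text \<open>Both pole regions come arbitrarily close to a point of the segment, and off the real
  axis the rates of the two poles differ.\<close>

lemma zero_near_real_segment:
  assumes "Im x0 = 0" "pi * exp 1 * norm x0 \<le> 1" "\<epsilon> > 0"
  shows "\<exists>n r. exp_conv euler_coeff n r = 0 \<and> r \<in> ball x0 \<epsilon>"
proof -
  \<comment> \<open>With \<open>pi e c = 1 / 2\<close>, shrinking \<open>x0\<close> by
    \<open>1 - \<delta>\<close> and then moving it by \<open>\<delta> c\<close> gives
    \<open>pi e |x| \<le> 1 - \<delta> / 2\<close>.\<close>
  define c where "c = 1 / (2 * (pi * exp 1))"
  define \<delta> where "\<delta> = min (1 / 2) (\<epsilon> / 2)"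
  have \<delta>: "0 < \<delta>" "\<delta> < 1" "\<delta> \<le> \<epsilon> / 2" using assms(3) by (auto simp: \<delta>_def)
  have pe: "pi * exp 1 > 1"
    using pi_gt3 exp_ge_add_one_self[of 1] mult_strict_mono[of 1 pi 1 "exp 1"] by auto
  have c: "0 < c" "c < 1" "pi * exp 1 * c = 1 / 2"
    using pe by (auto simp: c_def divide_less_eq)
  \<comment> \<open>For \<open>s = 1\<close> the point lies below the real axis and for
    \<open>s = -1\<close> above it, in the respective pole region.\<close>
  define x where "x s = of_real (1 - \<delta>) * x0 - \<i> * of_real (s * \<delta> * c)" for s
  have x: "x s \<in> ball x0 \<epsilon> \<inter> pole_region s" if s: "s = 1 \<or> s = -1" for s :: real
  proof -
    have ns: "norm (\<i> * complex_of_real (s * \<delta> * c)) = \<delta> * c"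
    proof -
      have "\<bar>s\<bar> = 1" using s by auto
      then show ?thesis
        unfolding norm_mult norm_of_real abs_mult using \<delta> c by simp
    qed
    have "norm (x s) \<le> norm (of_real (1 - \<delta>) * x0) + norm (\<i> * complex_of_real (s * \<delta> * c))"
      unfolding x_def by (rule norm_triangle_ineq4)
    also have "\<dots> = (1 - \<delta>) * norm x0 + \<delta> * c"
      using \<delta> unfolding ns norm_mult[of "of_real (1 - \<delta>)"] norm_of_real by simp
    finally have "pi * exp 1 * norm (x s) \<le> pi * exp 1 * ((1 - \<delta>) * norm x0 + \<delta> * c)"
      by (intro mult_left_mono) auto
    also have "\<dots> = (1 - \<delta>) * (pi * exp 1 * norm x0) + \<delta> * (pi * exp 1 * c)"
      by (simp add: algebra_simps)
    also have "\<dots> \<le> (1 - \<delta>) * 1 + \<delta> * (1 / 2)"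
      using assms(2) \<delta> c(3) by (intro add_mono mult_left_mono) auto
    also have "\<dots> < 1" using \<delta> by simp
    finally have 1: "pi * exp 1 * norm (x s) < 1" .
    have "pi * 1 * norm (x s) \<le> pi * exp 1 * norm (x s)"
      by (intro mult_right_mono mult_left_mono) auto
    then have "pi * norm (x s) < 1" using 1 by linarith
    then have 2: "norm (x s) < 1 / pi" by (simp add: less_divide_eq mult.commute)
    have "s * Im (x s) = - (\<delta> * c)"
      using s assms(1) by (auto simp: x_def)
    then have 3: "s * Im (x s) < 0" using \<delta> c by simp
    then have "0 < pi * (- (s * Im (x s)))" by (intro mult_pos_pos) auto
    then have "1 < exp (- s * pi * Im (x s))" by (simp add: mult_ac)
    with 1 have "pi * exp 1 * norm (x s) < exp (- s * pi * Im (x s))" by linarith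
    with 2 3 have "x s \<in> pole_region s" by (simp add: pole_region_def)
    have "norm x0 \<le> pi * exp 1 * norm x0" using pe by (simp add: mult_le_cancel_right1)
    then have "norm x0 \<le> 1" using assms(2) by linarith
    have "x0 - x s = of_real \<delta> * x0 + \<i> * of_real (s * \<delta> * c)"
      by (simp add: x_def algebra_simps)
    then have "dist x0 (x s) \<le> norm (of_real \<delta> * x0) + norm (\<i> * complex_of_real (s * \<delta> * c))"
      unfolding dist_norm by (metis norm_triangle_ineq)
    also have "\<dots> = \<delta> * (norm x0 + c)"
      using \<delta> unfolding ns norm_mult[of "of_real \<delta>"] norm_of_real by (simp add: algebra_simps)
    also have "\<dots> < \<delta> * 2"
      using \<open>norm x0 \<le> 1\<close> c \<delta> by (intro mult_strict_left_mono) auto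
    also have "\<dots> \<le> \<epsilon>" using \<delta> by simp
    finally show ?thesis using \<open>x s \<in> pole_region s\<close> by simp
  qed
  have "Im (x (-1)) \<noteq> 0" using \<delta> c assms(1) by (simp add: x_def)
  then have "exp (- (-1) * pi * Im (x (-1))) / pi \<noteq> exp (- 1 * pi * Im (x (-1))) / pi"
    by simp
  moreover have "(\<lambda>n. root n (norm (exp_conv euler_coeff n (x (-1))))) \<longlonglongrightarrow> exp (- (-1) * pi * Im (x (-1))) / pi"
    using x[of "-1"] by (intro root_tendsto_pole_region) auto
  ultimately show ?thesis
    using x[of 1] x[of "-1"] by (intro zero_in_ball[of 1 x0 \<epsilon> "x (-1)"]) auto
qed

text \<open>On the curve the pole and the saddle point balance. A small contraction towards the
  origin enters the pole region, and a small horizontal move away from the imaginary axis enters the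
  saddle region.\<close>

lemma zero_near_curve:
  assumes s: "s = 1 \<or> s = (-1 :: real)" and "norm x0 \<le> 1 / pi" "s * Im x0 < 0"
    and eq: "pi * exp 1 * norm x0 = exp (- s * pi * Im x0)" and "\<epsilon> > 0"
  shows "\<exists>n r. exp_conv euler_coeff n r = 0 \<and> r \<in> ball x0 \<epsilon>"
proof -
  define a where "a = - s * pi * Im x0"
  have a0: "a > 0"
    using mult_pos_pos[OF pi_gt_zero, of "- (s * Im x0)"] assms(3) by (simp add: a_def mult_ac)
  have absIm: "pi * \<bar>Im x0\<bar> = a" using s assms(3) by (auto simp: a_def)
  have "1 / pi \<le> 1" using pi_gt3 by (simp add: divide_le_eq)
  then have nx1: "norm x0 \<le> 1" using assms(2) by linarith
  have "pi * \<bar>Im x0\<bar> \<le> pi * norm x0" using abs_Im_le_cmod[of x0] by simp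
  also have "\<dots> \<le> 1" using assms(2) by (simp add: le_divide_eq mult.commute)
  finally have a1: "a \<le> 1" unfolding absIm .
  define \<delta> where "\<delta> = min (1 / 2) (\<epsilon> / 2)"
  have \<delta>: "0 < \<delta>" "\<delta> < 1" "\<delta> < \<epsilon>" using assms(5) by (auto simp: \<delta>_def)
  define x where "x = of_real (1 - \<delta>) * x0"
  have nx: "norm x = (1 - \<delta>) * norm x0" using \<delta> unfolding x_def norm_mult norm_of_real by simp
  have Imx: "Im x = (1 - \<delta>) * Im x0" by (simp add: x_def)
  have x0nz: "norm x0 > 0" using assms(3) by auto
  have "x \<in> pole_region s"
    unfolding pole_region_def mem_Collect_eq
  proof (intro conjI)
    have "norm x < 1 * norm x0" unfolding nx using \<delta> x0nz by (intro mult_strict_right_mono) auto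
    with assms(2) show "norm x < 1 / pi" by linarith
    have "(1 - \<delta>) * (s * Im x0) < 0" using \<delta> by (intro mult_pos_neg[OF _ assms(3)]) auto
    then show "s * Im x < 0" by (simp add: Imx mult_ac)
    \<comment> \<open>The aim is \<open>1 - \<delta> < exp (- \<delta> a)\<close>. The square
      supplies strictness even for \<open>a = 1\<close>, where the first inequality is an
      equality.\<close>
    have "1 - \<delta> \<le> 1 - \<delta> * a"
      using a1 \<delta> by (simp add: mult_le_cancel_left2)
    also have "\<dots> < (1 + (- \<delta> * a / 2))\<^sup>2"
      using a0 \<delta> by (simp add: power2_eq_square algebra_simps)
    also have "\<dots> \<le> (exp (- \<delta> * a / 2))\<^sup>2"
    proof (rule power_mono[OF exp_ge_add_one_self])
      have "\<delta> * a \<le> 1 * 1" using a0 a1 \<delta> by (intro mult_mono) auto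
      then show "0 \<le> 1 + (- \<delta> * a / 2)" by simp
    qed
    also have "\<dots> = exp (- \<delta> * a)"
      by (simp add: exp_double[symmetric])
    finally have "(1 - \<delta>) * exp a < exp (- \<delta> * a) * exp a"
      by simp
    also have "\<dots> = exp ((1 - \<delta>) * a)"
      by (simp add: exp_add[symmetric] algebra_simps)
    finally have "(1 - \<delta>) * exp a < exp ((1 - \<delta>) * a)" .
    moreover have "pi * exp 1 * norm x = (1 - \<delta>) * exp a"
      unfolding nx a_def eq[symmetric] by (simp only: mult_ac)
    moreover have "- s * pi * Im x = (1 - \<delta>) * a"
      by (simp add: Imx a_def)
    ultimately show "pi * exp 1 * norm x < exp (- s * pi * Im x)"
      by (simp only:)
  qed
  moreover have "x \<in> ball x0 \<epsilon>"
  proof -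
    have "x0 - x = of_real \<delta> * x0" by (simp add: x_def algebra_simps)
    then have "dist x0 x = \<delta> * norm x0" using \<delta> by (simp add: dist_norm norm_mult)
    also have "\<dots> \<le> \<delta> * 1" using nx1 \<delta> by (intro mult_left_mono) auto
    finally show ?thesis using \<delta> by simp
  qed
  ultimately have U: "ball x0 \<epsilon> \<inter> pole_region s \<noteq> {}" by blast
  \<comment> \<open>The sign moves \<open>x0\<close> away from the imaginary axis: the modulus grows
    while \<open>Im x0\<close>, and with it the rate of the pole, stays fixed.\<close>
  define t where "t = (if Re x0 \<ge> 0 then \<delta> else - \<delta>)"
  define x1 where "x1 = x0 + of_real t"
  have Im1: "Im x1 = Im x0" by (simp add: x1_def)
  have "0 < \<delta> * (2 * \<bar>Re x0\<bar> + \<delta>)"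
    using \<delta> by (intro mult_pos_pos add_nonneg_pos) auto
  also have "\<dots> = (Re x0 + t)\<^sup>2 - (Re x0)\<^sup>2"
    by (auto simp: t_def power2_eq_square algebra_simps)
  finally have "norm x0 < norm x1"
    unfolding cmod_def by (simp add: x1_def)
  then have gt: "pi * exp 1 * norm x0 < pi * exp 1 * norm x1"
    by (intro mult_strict_left_mono) auto
  have "exp (pi * \<bar>Im x1\<bar>) < pi * exp 1 * norm x1"
    using gt unfolding Im1 absIm eq a_def by simp
  then have S: "x1 \<in> saddle_region" by (simp add: saddle_region_def)
  have "exp 1 * norm x1 \<noteq> exp (- s * pi * Im x1) / pi"
    using gt unfolding Im1 eq[symmetric] by (auto simp: field_simps)
  moreover have "x1 \<in> ball x0 \<epsilon>" using \<delta> by (auto simp: x1_def dist_norm t_def)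
  ultimately show ?thesis
    using zero_in_ball[OF s U _ root_tendsto_saddle_region[OF S]] by blast
qed

text \<open>The curves meet the real axis only where \<open>pi e |x| = 1\<close>, at the endpoints
  of the segment, so real points reduce to the segment and all others have
  \<open>s * Im x0 < 0\<close>.\<close>

lemma zero_near_attractor_point:
  assumes "x0 \<in> euler_attractor_set" "\<epsilon> > 0"
  shows "\<exists>n r. exp_conv euler_coeff n r = 0 \<and> r \<in> ball x0 \<epsilon>"
proof (cases "Im x0 = 0")
  case True
  then show ?thesis
    using assms by (intro zero_near_real_segment) (auto simp: mem_euler_attractor_set_iff)
next
  case False
  then obtain s where s: "s = 1 \<or> s = -1" "norm x0 \<le> 1 / pi" "s * Im x0 \<le> 0"
      "pi * exp 1 * norm x0 = exp (- s * pi * Im x0)"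
    using assms(1) unfolding mem_euler_attractor_set_iff by blast
  moreover have "s * Im x0 \<noteq> 0" using s(1) False by auto
  ultimately show ?thesis
    using assms(2) by (intro zero_near_curve[of s]) auto
qed

theorem mainTheorem1:
  shows "zero_attractor (\<lambda>n. pcompose (euler_poly n) [:0, of_nat n:]) euler_attractor_set"
  unfolding zero_attractor_def poly_euler_poly_scaled mult_eq_0_iff
  using zeros_near_attractor zero_near_attractor_point by simp

end
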